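(* Let $n>0$ be an integer and $D=4n$. Let $Z_c\to\mathbb{P}^1$ be a one-parameter family of vector bundles (with parameter $c$, non-zero and possibly infinite) with patching $$\hat T=T+\frac{S}{c\lambda^{2n-1}},\qquad \hat S=\lambda^{2-D}S.$$ For $c\ne\infty$ the normal bundle to all rational curves $X_x$ (global sections of $Z_c\to\mathbb{P}^1$) is $N_x=\mathcal O(2n-1)\oplus\mathcal O(2n-1)$ and the homogeneous frame section is $$v=\begin{pmatrix} v^0 \\ v^1 \end{pmatrix},\qquad v^A=e^{AA_1'\dots A_{2n-1}'}\pi_{A_1'}\cdots\pi_{A_{2n-1}'},$$ giving rise to a non-degenerate metric $$g=e_{AA_1'\dots A_{2n-1}'}\otimes e^{AA_1'\dots A_{2n-1}'}$$ on the moduli space $M$ of the curves. For $c=\infty$ the normal bundle to all rational curves $X_x$ is $N_x=\mathcal O\oplus\mathcal O(4n-2)$ and the homogeneous frame section is $$v=\begin{pmatrix} \theta \\ e^{A_1'\dots A_{4n-2}'}\pi_{A_1'}\cdots\pi_{A_{4n-2}'} \end{pmatrix},$$ giving rise to a Galilean structure with clock $\theta$ and $$h^{-1}=e_{A_1'\dots A_{4n-2}'}\otimes e^{A_1'\dots A_{4n-2}'}.$$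
   Context: Cover $\mathbb{P}^1$ by $U,\hat U$ with coordinates $\lambda$ and $\hat\lambda=\lambda^{-1}$; homogeneous coordinates are $[\pi_{A'}]$ with $\lambda=\pi_{0'}/\pi_{1'}$; $\mathcal O(k)$ has patching $\hat w=\lambda^{-k}w$. For $c=\infty$ the term $S/(c\lambda^{2n-1})$ is absent. Put $w=(T,S)$, $\hat w=(\hat T,\hat S)$. The space of global sections $X_x$ of $Z_c$ is $M$; a vertical slash denotes restriction to $X_x$. The normal bundle $N_x$ has patching $\mathcal F=\left(\frac{\partial\hat w^\mu}{\partial w^\nu}|\right)=\hat H\,\mathrm{diag}(\lambda^{-n_1},\lambda^{-n_2})H^{-1}$ with $H$, $\hat H$ holomorphic maps from $U$, $\hat U$ to $\mathrm{GL}(2,\mathbb{C})$, $N_x\cong\mathcal O(n_1)\oplus\mathcal O(n_2)$. The frame section is $v=H^{-1}dw|$ ($d$ is the exterior derivative on $M$ at fixed $\lambda$), whose components are polynomials of degree $n_1,n_2$ in $\lambda$ with one-form coefficients on $M$; written homogeneously these polynomials are contractions with $\pi_{A'}$ of one-forms $e^{\dots}$ totally symmetric in primed indices. It is defined up to the redundancy of multiplying by invertible global sections of $N_x\otimes N_x^*$ (varying with $x$); the assertions are about the induced geometry up to this redundancy. Indices $A\in\{0,1\}$ and $A'\in\{0',1'\}$ are lowered with the skew symbols $\epsilon_{AB}$, $\epsilon_{A'B'}$, and repeated indices are summed. A (complex) Galilean structure on a $(d+1)$-dimensional manifold is a pair $(h,\theta)$, with $h$ a symmetric contravariant 2-tensor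 of rank $d$ and $\theta$ a closed one-form (the clock) spanning its kernel. Here $h$ is obtained from the degenerate covariant $h^{-1}$ by: $U$ is the unique vector field with $\theta(U)=1$, $h^{-1}(U,\cdot)=0$, and $h$ is the unique solution of $h^{ab}h_{bc}=\delta^a_c-U^a\theta_c$, $h(\theta,\cdot)=0$. Since $\theta$ is determined only up to a non-vanishing function by the redundancy, closedness refers to a suitable choice of representative. *)

theory Defs
  imports "HOL-Analysis.Analysis" "HOL-Library.Multiset"
begin

text \<open>
  Unprimed and primed two-valued indices are both modelled by the numeral type \<^typ>\<open>2\<close>, whose two
  elements are literally \<open>0\<close> and \<open>1\<close>; the coordinates \<open>w = (T, S)\<close> are \<open>T = w $ 0\<close>, \<open>S = w $ 1\<close>,
  and the homogeneous coordinates satisfy \<open>\<lambda> = \<pi> $ 0 / \<pi> $ 1\<close>.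
  A covector, resp. a tensor with two indices, on \<open>complex ^ 'd\<close> is given by its components.
\<close>

subsection \<open>Holomorphic functions of several variables\<close>

definition holomorphic_vec :: "(complex ^ 'd \<Rightarrow> complex) \<Rightarrow> bool" where
  "holomorphic_vec f \<longleftrightarrow>
     (\<forall>x. \<exists>f'. (f has_derivative f') (at x) \<and> (\<forall>k v. f' (k *s v) = k * f' v))"

definition jointly_holomorphic :: "(complex ^ 'd \<Rightarrow> complex \<Rightarrow> complex) \<Rightarrow> bool" where
  "jointly_holomorphic f \<longleftrightarrow>
     (\<forall>p. \<exists>f'. ((\<lambda>(x, l). f x l) has_derivative f') (at p) \<and>
        (\<forall>k v z. f' (k *s v, k * z) = k * f' (v, z)))"

definition partial :: "'d \<Rightarrow> (complex ^ 'd \<Rightarrow> complex) \<Rightarrow> complex ^ 'd \<Rightarrow> complex" where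
  "partial a f x = deriv (\<lambda>z. f (x + axis a z)) 0"

subsection \<open>The family of bundles and its global sections\<close>

datatype bundle_parameter = Fin complex | Infty

definition patching ::
    "nat \<Rightarrow> nat \<Rightarrow> bundle_parameter \<Rightarrow> complex \<Rightarrow> complex ^ 2 \<Rightarrow> complex ^ 2" where
  "patching n D c l w = (\<chi> \<mu>.
     if \<mu> = 0
     then w $ 0 + (case c of Fin a \<Rightarrow> w $ 1 / (a * l ^ (2 * n - 1)) | Infty \<Rightarrow> 0)
     else l powi (2 - int D) * w $ 1)"

text \<open>
  A section over the projective line is a pair \<open>(w, w')\<close> of its representatives over the two
  coordinate patches, the second one being a function of the coordinate \<open>1 / \<lambda>\<close>.
\<close>

type_synonym curve = "(complex \<Rightarrow> complex ^ 2) \<times> (complex \<Rightarrow> complex ^ 2)"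

definition global_sections :: "nat \<Rightarrow> nat \<Rightarrow> bundle_parameter \<Rightarrow> curve set" where
  "global_sections n D c = {(w, w').
     (\<forall>\<mu>. (\<lambda>l. w l $ \<mu>) holomorphic_on UNIV) \<and>
     (\<forall>\<mu>. (\<lambda>m. w' m $ \<mu>) holomorphic_on UNIV) \<and>
     (\<forall>l. l \<noteq> 0 \<longrightarrow> w' (inverse l) = patching n D c l (w l))}"

text \<open>
  The moduli space \<open>M\<close> is the complex vector space of global sections. Its complex manifold
  structure is the one of a finite-dimensional vector space, so it is described by linear
  coordinates, and tensor fields on \<open>M\<close> are represented by their components in them.
\<close>

definition linear_coordinates ::
    "nat \<Rightarrow> nat \<Rightarrow> bundle_parameter \<Rightarrow> (complex ^ 'd \<Rightarrow> curve) \<Rightarrow> bool" where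
  "linear_coordinates n D c \<phi> \<longleftrightarrow>
     bij_betw \<phi> UNIV (global_sections n D c) \<and>
     (\<forall>x y l. fst (\<phi> (x + y)) l = fst (\<phi> x) l + fst (\<phi> y) l \<and>
              snd (\<phi> (x + y)) l = snd (\<phi> x) l + snd (\<phi> y) l) \<and>
     (\<forall>k x l. fst (\<phi> (k *s x)) l = k *s fst (\<phi> x) l \<and>
              snd (\<phi> (k *s x)) l = k *s snd (\<phi> x) l)"

subsection \<open>Normal bundles and frame sections\<close>

definition normal_patching ::
    "nat \<Rightarrow> nat \<Rightarrow> bundle_parameter \<Rightarrow> curve \<Rightarrow> complex \<Rightarrow> complex ^ 2 ^ 2" where
  "normal_patching n D c X l =
     (\<chi> \<mu> \<nu>. partial \<nu> (\<lambda>u. patching n D c l u $ \<mu>) (fst X l))"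

definition diag2 :: "complex \<Rightarrow> complex \<Rightarrow> complex ^ 2 ^ 2" where
  "diag2 a b = (\<chi> i j. if i = j then (if i = 0 then a else b) else 0)"

definition splitting ::
    "(complex \<Rightarrow> complex ^ 2 ^ 2) \<Rightarrow> int \<Rightarrow> int \<Rightarrow>
     (complex \<Rightarrow> complex ^ 2 ^ 2) \<Rightarrow> (complex \<Rightarrow> complex ^ 2 ^ 2) \<Rightarrow> bool" where
  "splitting F n1 n2 H H' \<longleftrightarrow>
     (\<forall>l. invertible (H l)) \<and> (\<forall>m. invertible (H' m)) \<and>
     (\<forall>i j. (\<lambda>l. H l $ i $ j) holomorphic_on UNIV) \<and>
     (\<forall>i j. (\<lambda>m. H' m $ i $ j) holomorphic_on UNIV) \<and>
     (\<forall>l. l \<noteq> 0 \<longrightarrow>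
        F l = H' (inverse l) ** diag2 (l powi (- n1)) (l powi (- n2)) ** matrix_inv (H l))"

text \<open>The bundle with patching matrix \<open>F\<close> is isomorphic to \<open>\<O>(n1) \<oplus> \<O>(n2)\<close>:\<close>

definition isomorphic_to_sum :: "(complex \<Rightarrow> complex ^ 2 ^ 2) \<Rightarrow> int \<Rightarrow> int \<Rightarrow> bool" where
  "isomorphic_to_sum F n1 n2 \<longleftrightarrow> (\<exists>H H'. splitting F n1 n2 H H')"

text \<open>
  A choice of splittings of the normal bundles of all curves, depending holomorphically on the
  curve. Any two choices differ by invertible global sections of \<open>N\<^sub>x \<otimes> N\<^sub>x\<^sup>*\<close> varying
  holomorphically with \<open>x\<close>; this is the redundancy in the frame section.
\<close>

definition splitting_family ::
    "nat \<Rightarrow> nat \<Rightarrow> bundle_parameter \<Rightarrow> (complex ^ 'd \<Rightarrow> curve) \<Rightarrow> int \<Rightarrow> int \<Rightarrow>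
     (complex ^ 'd \<Rightarrow> complex \<Rightarrow> complex ^ 2 ^ 2) \<Rightarrow>
     (complex ^ 'd \<Rightarrow> complex \<Rightarrow> complex ^ 2 ^ 2) \<Rightarrow> bool" where
  "splitting_family n D c \<phi> n1 n2 H H' \<longleftrightarrow>
     (\<forall>x. splitting (normal_patching n D c (\<phi> x)) n1 n2 (H x) (H' x)) \<and>
     (\<forall>i j. jointly_holomorphic (\<lambda>x l. H x l $ i $ j)) \<and>
     (\<forall>i j. jointly_holomorphic (\<lambda>x m. H' x m $ i $ j))"

definition dw :: "(complex ^ 'd \<Rightarrow> curve) \<Rightarrow> complex ^ 'd \<Rightarrow> complex \<Rightarrow> 2 \<Rightarrow> complex ^ 'd" where
  "dw \<phi> x l \<mu> = (\<chi> a. partial a (\<lambda>y. fst (\<phi> y) l $ \<mu>) x)"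

definition frame_section ::
    "(complex ^ 'd \<Rightarrow> curve) \<Rightarrow> (complex ^ 'd \<Rightarrow> complex \<Rightarrow> complex ^ 2 ^ 2) \<Rightarrow>
     complex ^ 'd \<Rightarrow> complex \<Rightarrow> 2 \<Rightarrow> complex ^ 'd" where
  "frame_section \<phi> H x l A = (\<Sum>\<mu>\<in>UNIV. matrix_inv (H x l) $ A $ \<mu> *s dw \<phi> x l \<mu>)"

subsection \<open>Spinor-valued one-forms\<close>

text \<open>
  A field of one-forms \<open>e\<close> with \<open>k\<close> primed indices is a function of lists of length \<open>k\<close>; the values
  at lists of other lengths are irrelevant.
\<close>

definition multi_indices :: "nat \<Rightarrow> 2 list set" where
  "multi_indices k = {I. length I = k}"

definition holomorphic_one_form :: "(complex ^ 'd \<Rightarrow> complex ^ 'd) \<Rightarrow> bool" where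
  "holomorphic_one_form \<alpha> \<longleftrightarrow> (\<forall>a. holomorphic_vec (\<lambda>x. \<alpha> x $ a))"

definition symmetric_one_forms :: "nat \<Rightarrow> (complex ^ 'd \<Rightarrow> 2 list \<Rightarrow> complex ^ 'd) \<Rightarrow> bool" where
  "symmetric_one_forms k e \<longleftrightarrow>
     (\<forall>I\<in>multi_indices k. holomorphic_one_form (\<lambda>x. e x I)) \<and>
     (\<forall>x. \<forall>I\<in>multi_indices k. \<forall>J\<in>multi_indices k. mset I = mset J \<longrightarrow> e x I = e x J)"

text \<open>
  \<open>v\<close>, written homogeneously of degree \<open>k\<close> as \<open>\<pi>\<^sub>1\<^sup>k v(\<pi>\<^sub>0 / \<pi>\<^sub>1)\<close>, is the contraction of \<open>e\<close> with
  \<open>k\<close> copies of \<open>\<pi>\<close>. For totally symmetric \<open>e\<close> this determines \<open>e\<close> uniquely.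
\<close>

definition homogeneous_form ::
    "nat \<Rightarrow> (2 list \<Rightarrow> complex ^ 'd) \<Rightarrow> (complex \<Rightarrow> complex ^ 'd) \<Rightarrow> bool" where
  "homogeneous_form k e v \<longleftrightarrow>
     (\<forall>\<pi>::complex ^ 2. \<pi> $ 1 \<noteq> 0 \<longrightarrow>
        (\<pi> $ 1) ^ k *s v (\<pi> $ 0 / \<pi> $ 1) =
        (\<Sum>I\<in>multi_indices k. (\<Prod>i<k. \<pi> $ (I ! i)) *s e I))"

definition skew :: "2 \<Rightarrow> 2 \<Rightarrow> complex" where
  "skew A B = (if A = 0 \<and> B = 1 then 1 else if A = 1 \<and> B = 0 then - 1 else 0)"

text \<open>
  Indices are lowered by \<open>\<xi>\<^sub>B = \<xi>\<^sup>A \<epsilon>\<^sub>A\<^sub>B\<close>. The opposite convention gives the same \<open>frame_metric\<close> and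
  \<open>spatial_metric\<close> below, where the number of lowered indices is even.
\<close>

definition lower_primed :: "nat \<Rightarrow> (2 list \<Rightarrow> complex ^ 'd) \<Rightarrow> 2 list \<Rightarrow> complex ^ 'd" where
  "lower_primed k e I = (\<Sum>J\<in>multi_indices k. (\<Prod>i<k. skew (J ! i) (I ! i)) *s e J)"

definition frame_metric ::
    "nat \<Rightarrow> (2 \<Rightarrow> 2 list \<Rightarrow> complex ^ 'd) \<Rightarrow> complex ^ 'd ^ 'd" where
  "frame_metric k e = (\<chi> a b.
     \<Sum>A\<in>UNIV. \<Sum>I\<in>multi_indices k.
       (\<Sum>B\<in>UNIV. skew B A * lower_primed k (e B) I $ a) * e A I $ b)"

definition spatial_metric :: "nat \<Rightarrow> (2 list \<Rightarrow> complex ^ 'd) \<Rightarrow> complex ^ 'd ^ 'd" where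
  "spatial_metric k e = (\<chi> a b. \<Sum>I\<in>multi_indices k. lower_primed k e I $ a * e I $ b)"

subsection \<open>Metrics and Galilean structures\<close>

definition symmetric_tensor_field :: "(complex ^ 'd \<Rightarrow> complex ^ 'd ^ 'd) \<Rightarrow> bool" where
  "symmetric_tensor_field g \<longleftrightarrow>
     (\<forall>a b. holomorphic_vec (\<lambda>x. g x $ a $ b)) \<and> (\<forall>x. transpose (g x) = g x)"

definition nondegenerate_metric :: "(complex ^ 'd \<Rightarrow> complex ^ 'd ^ 'd) \<Rightarrow> bool" where
  "nondegenerate_metric g \<longleftrightarrow> symmetric_tensor_field g \<and> (\<forall>x. invertible (g x))"

definition closed_one_form :: "(complex ^ 'd \<Rightarrow> complex ^ 'd) \<Rightarrow> bool" where
  "closed_one_form \<alpha> \<longleftrightarrow> holomorphic_one_form \<alpha> \<and>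
     (\<forall>x a b. partial a (\<lambda>y. \<alpha> y $ b) x = partial b (\<lambda>y. \<alpha> y $ a) x)"

definition galilean_structure ::
    "(complex ^ 'd \<Rightarrow> complex ^ 'd ^ 'd) \<Rightarrow> (complex ^ 'd \<Rightarrow> complex ^ 'd) \<Rightarrow> bool" where
  "galilean_structure h \<theta> \<longleftrightarrow>
     symmetric_tensor_field h \<and> (\<forall>x. rank (h x) = CARD('d) - 1) \<and>
     closed_one_form \<theta> \<and> (\<forall>x. {\<alpha>. h x *v \<alpha> = 0} = range (\<lambda>k. k *s \<theta> x))"

definition pairing :: "complex ^ 'd \<Rightarrow> complex ^ 'd \<Rightarrow> complex" where
  "pairing \<alpha> V = (\<Sum>a\<in>UNIV. \<alpha> $ a * V $ a)"

text \<open>The conditions defining \<open>U\<close> and \<open>h\<close> at a point; \<open>q\<close> stands for the covariant tensor \<open>h\<^sup>-\<^sup>1\<close>.\<close>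

definition field_of_observers :: "complex ^ 'd ^ 'd \<Rightarrow> complex ^ 'd \<Rightarrow> complex ^ 'd \<Rightarrow> bool" where
  "field_of_observers q \<theta> U \<longleftrightarrow> pairing \<theta> U = 1 \<and> q *v U = 0"

definition raised_metric ::
    "complex ^ 'd ^ 'd \<Rightarrow> complex ^ 'd \<Rightarrow> complex ^ 'd \<Rightarrow> complex ^ 'd ^ 'd \<Rightarrow> bool" where
  "raised_metric q \<theta> U h \<longleftrightarrow> transpose h = h \<and>
     h ** q = (\<chi> a c. (if a = c then 1 else 0) - U $ a * \<theta> $ c) \<and> h *v \<theta> = 0"

text \<open>
  \<open>q\<close> and \<open>\<theta>\<close> determine \<open>U\<close> and \<open>h\<close> uniquely at each point, and \<open>(h, \<theta>)\<close> is a Galilean structure.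
\<close>

definition induces_galilean_structure ::
    "(complex ^ 'd \<Rightarrow> complex ^ 'd ^ 'd) \<Rightarrow> (complex ^ 'd \<Rightarrow> complex ^ 'd) \<Rightarrow> bool" where
  "induces_galilean_structure q \<theta> \<longleftrightarrow>
     (\<exists>U h. (\<forall>x. field_of_observers (q x) (\<theta> x) (U x) \<and>
                 (\<forall>V. field_of_observers (q x) (\<theta> x) V \<longrightarrow> V = U x)) \<and>
            (\<forall>x. raised_metric (q x) (\<theta> x) (U x) (h x) \<and>
                 (\<forall>k. raised_metric (q x) (\<theta> x) (U x) k \<longrightarrow> k = h x)) \<and>
            galilean_structure h \<theta>)"

end

(*
  The transition matrix of the bundle is independent of the curve and of the fibre coordinates, so
  the moduli space of sections is a vector space of dimension D and dw is evaluation of sections.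
  In a frame H splitting the normal bundle the components of v = H^-1 dw patch like sections of O(n_1)
  and O(n_2); by Liouville's theorem they are polynomials in lambda, and their n_1 + n_2 + 2 = D
  coefficients form a coframe, because a section with v = 0 vanishes. The contraction with the skew
  symbols pairs the coefficient of lambda^j with that of lambda^(k - j), up to the nonzero factor
  (-1)^j / binom(k, j), so in this coframe it is a monomial matrix.

  For c = infinity the entry (H^-1)_01 is a section of a bundle of negative degree, hence zero, so the
  clock is a function multiple of the exact form dT. Adding theta theta^T to the covariant tensor q
  makes it invertible with inverse B, and U = B theta, h = B - U U^T.
*)

theory Submission
  imports Defs "HOL-Complex_Analysis.Cauchy_Integral_Formula"
begin

text \<open>This is the obstacle that shapes the proof: the coefficients are obtained separately for
  each curve, and their holomorphy in the curve has to be recovered from the frame section at fixed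
  points of the line. The same closure properties, including those for entries of inverse matrices,
  are needed for entire functions of \<lambda> and for holomorphic functions on the moduli space,
  hence an abstract algebra of functions. The exponents fit because \<open>D - 2 = 4 * n - 2\<close>
  is twice the pole order \<open>2 * n - 1\<close>: a nonzero coupling can then balance the two
  summands, and both degrees become \<open>2 * n - 1\<close>. Oddness of \<open>2 * n - 1\<close>
  compensates the skew sign of the unprimed index, and evenness of \<open>4 * n - 2\<close> needs no
  such compensation, so both tensors are symmetric.\<close>

lemma matrix_inv_mult:
  assumes "invertible A"
  shows "A ** matrix_inv A = mat 1" "matrix_inv A ** A = mat 1"
  using someI_ex[OF assms[unfolded invertible_def]] unfolding matrix_inv_def by auto

section \<open>Algebras of holomorphic functions\<close>

text \<open>Closure under reciprocals of nowhere vanishing functions is the property that lets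
  inverse matrices be formed inside the algebra.\<close>

locale function_algebra =
  fixes P :: "('a \<Rightarrow> complex) \<Rightarrow> bool"
  assumes const: "P (\<lambda>_. k)"
    and add: "P f \<Longrightarrow> P g \<Longrightarrow> P (\<lambda>x. f x + g x)"
    and mult: "P f \<Longrightarrow> P g \<Longrightarrow> P (\<lambda>x. f x * g x)"
    and inverse: "P f \<Longrightarrow> (\<And>x. f x \<noteq> 0) \<Longrightarrow> P (\<lambda>x. inverse (f x))"
begin

lemma sum: "(\<And>i. i \<in> I \<Longrightarrow> P (f i)) \<Longrightarrow> P (\<lambda>x. \<Sum>i\<in>I. f i x)"
  by (induction I rule: infinite_finite_induct) (auto intro: const add)

lemma prod: "(\<And>i. i \<in> I \<Longrightarrow> P (f i)) \<Longrightarrow> P (\<lambda>x. \<Prod>i\<in>I. f i x)"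
  by (induction I rule: infinite_finite_induct) (auto intro: const mult)

lemma diff: "P f \<Longrightarrow> P g \<Longrightarrow> P (\<lambda>x. f x - g x)"
  using add[OF _ mult[OF const[of "-1"]], of f g] by simp

lemma divide_const: "P f \<Longrightarrow> P (\<lambda>x. f x / k)"
  using mult[OF _ const[of "inverse k"], of f] by (simp add: divide_inverse)

lemma det:
  assumes "\<And>i j. P (\<lambda>x. M x $ i $ j)"
  shows "P (\<lambda>x. det (M x))"
  unfolding det_def by (intro sum mult const prod assms)

text \<open>Since \<open>matrix_inv\<close> is defined by choice, its entries are first identified
  by Cramer's rule as determinants in the entries of \<open>M x\<close>, divided by the nowhere
  vanishing \<open>det (M x)\<close>.\<close>

lemma matrix_inv:
  fixes M :: "'a \<Rightarrow> complex ^ 'n ^ 'n"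
  assumes P: "\<And>i j. P (\<lambda>x. M x $ i $ j)" and inv: "\<And>x. invertible (M x)"
  shows "P (\<lambda>x. matrix_inv (M x) $ i $ j)"
proof -
  have nz: "det (M x) \<noteq> 0" for x
    using inv invertible_det_nz by blast
  have "M x *v column j (matrix_inv (M x)) = axis j 1" for x
  proof -
    have "M x *v column j (matrix_inv (M x)) = column j (M x ** matrix_inv (M x))"
      by (simp add: vec_eq_iff column_def matrix_vector_mult_def matrix_matrix_mult_def)
    then show ?thesis
      by (simp add: matrix_inv_mult(1)[OF inv] column_def mat_def axis_def vec_eq_iff)
  qed
  then have "column j (matrix_inv (M x)) =
      (\<chi> k. det (\<chi> i j'. if j' = k then axis j 1 $ i else M x $ i $ j') / det (M x))" for x
    using cramer[OF nz] by blast
  then have "column j (matrix_inv (M x)) $ i =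
      det (\<chi> i' j'. if j' = i then axis j 1 $ i' else M x $ i' $ j') * inverse (det (M x))" for x
    by (simp add: divide_inverse)
  then have eq: "matrix_inv (M x) $ i $ j =
      det (\<chi> i' j'. if j' = i then axis j 1 $ i' else M x $ i' $ j') * inverse (det (M x))" for x
    by (simp add: column_def)
  have "P (\<lambda>x. (\<chi> i' j'. if j' = i then axis j 1 $ i' else M x $ i' $ j') $ a $ b)" for a b
    by (cases "b = i") (auto intro: const P)
  then show ?thesis
    unfolding eq by (intro mult det inverse P nz)
qed

text \<open>For \<open>f\<close> of degree \<open>k + 1\<close>, \<open>f (2 * l) - 2 ^ (k + 1) * f l\<close> has no leading term.\<close>

lemma polynomial_coefficients:
  assumes "\<And>l::complex. P (\<lambda>x. \<Sum>j\<le>k. c j x * l ^ j)" and "j \<le> k"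
  shows "P (c j)"
  using assms
proof (induction k arbitrary: c j)
  case 0
  then show ?case by simp
next
  case (Suc k)
  define d where "d j x = (2 ^ j - 2 ^ Suc k) * c j x" for j :: nat and x
  have "(\<Sum>j\<le>k. d j x * l ^ j) =
      (\<Sum>j\<le>Suc k. c j x * (2 * l) ^ j) - 2 ^ Suc k * (\<Sum>j\<le>Suc k. c j x * l ^ j)" for x l
    by (simp add: d_def sum_distrib_left sum_subtractf[symmetric] power_mult_distrib algebra_simps)
  then have "P (\<lambda>x. \<Sum>j\<le>k. d j x * l ^ j)" for l
    by (simp only:) (intro diff mult const Suc.prems(1))
  then have d: "P (d j)" if "j \<le> k" for j
    using Suc.IH that by blast
  have low: "P (c j)" if "j \<le> k" for j
  proof -
    have "(2::complex) ^ j \<noteq> 2 ^ Suc k"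
    proof
      assume "(2::complex) ^ j = 2 ^ Suc k"
      then have "norm ((2::complex) ^ j) = norm ((2::complex) ^ Suc k)"
        by simp
      then have "(2::real) ^ j = 2 ^ Suc k"
        unfolding norm_power by simp
      then show False
        using power_inject_exp[of "2::real" j "Suc k"] that by simp
    qed
    then have "c j = (\<lambda>x. d j x / (2 ^ j - 2 ^ Suc k))"
      by (simp add: d_def fun_eq_iff)
    then show ?thesis
      using divide_const[OF d[OF that], of "2 ^ j - 2 ^ Suc k"] by simp
  qed
  \<comment> \<open>The induction reaches only the lower coefficients; evaluation at
    \<open>1\<close> minus their sum leaves the top one.\<close>
  have "c (Suc k) = (\<lambda>x. (\<Sum>j\<le>Suc k. c j x * 1 ^ j) - (\<Sum>j\<le>k. c j x))"
    by (simp add: fun_eq_iff)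
  moreover have "P (\<lambda>x. (\<Sum>j\<le>Suc k. c j x * 1 ^ j) - (\<Sum>j\<le>k. c j x))"
    by (intro diff Suc.prems(1) sum low) simp
  ultimately have "P (c (Suc k))"
    by simp
  then show ?case
    using low Suc.prems(2) by (auto simp: le_Suc_eq)
qed

end

interpretation entire: function_algebra "\<lambda>f. f holomorphic_on UNIV"
  by standard (auto intro!: holomorphic_intros)

text \<open>\<open>holomorphic_vec\<close> means real differentiability with a complex homogeneous
  derivative, so each closure property exhibits the derivative and checks that it commutes with
  complex scalars.\<close>

interpretation hol: function_algebra holomorphic_vec
proof
  fix f g :: "complex ^ 'a \<Rightarrow> complex" and k
  show "holomorphic_vec (\<lambda>_::complex ^ 'a. k)"
    unfolding holomorphic_vec_def using has_derivative_const by fastforce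
  show "holomorphic_vec (\<lambda>x. f x + g x)" if f: "holomorphic_vec f" and g: "holomorphic_vec g"
    unfolding holomorphic_vec_def
  proof
    fix x
    obtain f' g' where "(f has_derivative f') (at x)" "(g has_derivative g') (at x)"
      "\<And>k v. f' (k *s v) = k * f' v" "\<And>k v. g' (k *s v) = k * g' v"
      using f g unfolding holomorphic_vec_def by metis
    then show "\<exists>h. ((\<lambda>x. f x + g x) has_derivative h) (at x) \<and> (\<forall>k v. h (k *s v) = k * h v)"
      by (intro exI[of _ "\<lambda>v. f' v + g' v"]) (auto intro: has_derivative_add simp: algebra_simps)
  qed
  show "holomorphic_vec (\<lambda>x. f x * g x)" if f: "holomorphic_vec f" and g: "holomorphic_vec g"
    unfolding holomorphic_vec_def
  proof
    fix x
    obtain f' g' where "(f has_derivative f') (at x)" "(g has_derivative g') (at x)"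
      "\<And>k v. f' (k *s v) = k * f' v" "\<And>k v. g' (k *s v) = k * g' v"
      using f g unfolding holomorphic_vec_def by metis
    then show "\<exists>h. ((\<lambda>x. f x * g x) has_derivative h) (at x) \<and> (\<forall>k v. h (k *s v) = k * h v)"
      by (intro exI[of _ "\<lambda>v. f x * g' v + f' v * g x"])
        (auto intro!: has_derivative_mult[THEN has_derivative_eq_rhs] simp: algebra_simps)
  qed
  show "holomorphic_vec (\<lambda>x. inverse (f x))" if f: "holomorphic_vec f" and nz: "\<And>x. f x \<noteq> 0"
    unfolding holomorphic_vec_def
  proof
    fix x
    obtain f' where "(f has_derivative f') (at x)" "\<And>k v. f' (k *s v) = k * f' v"
      using f unfolding holomorphic_vec_def by metis
    then show "\<exists>h. ((\<lambda>x. inverse (f x)) has_derivative h) (at x) \<and> (\<forall>k v. h (k *s v) = k * h v)"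
      using nz[of x]
      by (intro exI[of _ "\<lambda>v. - (inverse (f x) * f' v * inverse (f x))"])
        auto
  qed
qed

text \<open>The derivative of the restriction to fixed \<open>l\<close> is the joint derivative on
  vectors \<open>(v, 0)\<close>. Through this lemma the joint holomorphy of a splitting family
  yields holomorphy in the curve.\<close>

lemma jointly_holomorphic_imp_holomorphic_vec:
  assumes "jointly_holomorphic f"
  shows "holomorphic_vec (\<lambda>x. f x l)"
  unfolding holomorphic_vec_def
proof
  fix x
  obtain f' where f': "((\<lambda>(x, l). f x l) has_derivative f') (at (x, l))"
    "\<And>k v z. f' (k *s v, k * z) = k * f' (v, z)"
    using assms unfolding jointly_holomorphic_def by meson
  have "((\<lambda>y. (y, l)) has_derivative (\<lambda>v. (v, 0))) (at x)"
    by (auto intro!: derivative_eq_intros)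
  then have "((\<lambda>y. f y l) has_derivative (\<lambda>v. f' (v, 0))) (at x)"
    using has_derivative_compose[of "\<lambda>y. (y, l)" "\<lambda>v. (v, 0)" x UNIV "\<lambda>(x, l). f x l" f'] f'(1) by simp
  moreover have "f' (k *s v, 0) = k * f' (v, 0)" for k v
    using f'(2)[of k v 0] by simp
  ultimately show "\<exists>f'. ((\<lambda>x. f x l) has_derivative f') (at x) \<and> (\<forall>k v. f' (k *s v) = k * f' v)"
    by blast
qed

text \<open>Serves splittings that are the same for every curve.\<close>

lemma jointly_holomorphic_entire:
  assumes "g holomorphic_on UNIV"
  shows "jointly_holomorphic (\<lambda>x::complex ^ 'd. g)"
  unfolding jointly_holomorphic_def
proof
  fix p :: "(complex ^ 'd) \<times> complex"
  have "(g has_field_derivative deriv g (snd p)) (at (snd p))"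
    using assms holomorphic_derivI by fastforce
  then have "(g has_derivative (*) (deriv g (snd p))) (at (snd p))"
    by (simp add: has_field_derivative_def)
  then have "((\<lambda>(x, l). g l) has_derivative (\<lambda>(v, z). deriv g (snd p) * z)) (at p)"
    unfolding case_prod_unfold
    by (rule has_derivative_compose[OF has_derivative_snd[OF has_derivative_ident]])
  then show "\<exists>f'. ((\<lambda>(x, l). g l) has_derivative f') (at p) \<and>
      (\<forall>k (v::complex ^ 'd) z. f' (k *s v, k * z) = k * f' (v, z))"
    by (intro exI[of _ "\<lambda>(v, z). deriv g (snd p) * z"]) auto
qed

section \<open>Functions on the projective line\<close>

text \<open>Patching relations hold only on the overlap of the two patches; continuity carries their
  consequences to the missing point.\<close>

lemma entire_eq_except_zero:
  assumes "f holomorphic_on UNIV" "g holomorphic_on UNIV" "\<And>l. l \<noteq> 0 \<Longrightarrow> f l = g l"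
  shows "f = g"
proof -
  have "(f \<longlongrightarrow> f 0) (at 0)" "(g \<longlongrightarrow> g 0) (at 0)"
    using assms(1,2) by (metis UNIV_I continuous_on_eq_continuous_at holomorphic_on_imp_continuous_on
        isCont_def open_UNIV)+
  moreover have "\<forall>\<^sub>F l in at 0. f l = g l"
    using assms(3) by (auto simp: eventually_at_filter)
  ultimately have "f 0 = g 0"
    by (metis tendsto_cong tendsto_unique trivial_limit_at)
  then show ?thesis
    using assms(3) by (metis ext)
qed

text \<open>\<open>g\<close> is bounded on the closed unit disc, which bounds \<open>f l\<close> by
  a multiple of \<open>norm l ^ k\<close> outside that disc. An entire function of such growth is a
  polynomial of degree at most \<open>k\<close>.\<close>

lemma section_of_line_bundle:
  assumes f: "f holomorphic_on UNIV" and g: "g holomorphic_on UNIV"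
    and fg: "\<And>l. l \<noteq> 0 \<Longrightarrow> f l = l ^ k * g (inverse l)"
  obtains c where "\<And>l. f l = (\<Sum>j\<le>k. c j * l ^ j)"
proof -
  have "compact (g ` cball 0 1)"
    using g by (intro compact_continuous_image holomorphic_on_imp_continuous_on)
      auto
  then obtain B where B: "\<And>z. norm z \<le> 1 \<Longrightarrow> norm (g z) \<le> B"
    using compact_imp_bounded bounded_iff by (metis imageI mem_cball_0)
  have "norm (f z) \<le> B * norm z ^ k" if "1 \<le> norm z" for z
  proof -
    have "norm (g (inverse z)) \<le> B"
      using that by (intro B) (simp add: norm_inverse inverse_le_1_iff)
    moreover have "z \<noteq> 0" using that by auto
    ultimately show ?thesis
      by (simp add: fg norm_mult norm_power mult.commute mult_right_mono)
  qed
  then have "f l = (\<Sum>j\<le>k. (deriv ^^ j) f 0 / fact j * l ^ j)" for l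
    by (intro Liouville_polynomial[OF f])
  then show ?thesis by (rule that)
qed

lemma section_of_trivial_bundle:
  assumes "f holomorphic_on UNIV" "g holomorphic_on UNIV"
    and "\<And>l. l \<noteq> 0 \<Longrightarrow> f l = g (inverse l)"
  shows "f l = f 0"
proof -
  obtain c where "\<And>l. f l = (\<Sum>j\<le>0. c j * l ^ j)"
    using section_of_line_bundle[of f g 0] assms by auto
  then show ?thesis by simp
qed

text \<open>Multiplication by \<open>l ^ k\<close> produces a section of the trivial bundle; it is
  constant, and it vanishes at the origin because \<open>k > 0\<close>.\<close>

lemma section_of_negative_bundle:
  assumes "f holomorphic_on UNIV" "g holomorphic_on UNIV" "k > 0"
    and "\<And>l. l \<noteq> 0 \<Longrightarrow> l ^ k * f l = g (inverse l)"
  shows "f l = 0"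
proof -
  have "(\<lambda>l. l ^ k * f l) holomorphic_on UNIV"
    by (intro holomorphic_intros assms)
  from section_of_trivial_bundle[OF this assms(2)] assms(3,4) have "l ^ k * f l = 0" for l
    by (metis mult_zero_left power_0_left less_irrefl)
  then have "f = (\<lambda>_. 0)"
    by (intro entire_eq_except_zero assms(1)) auto
  then show ?thesis by simp
qed

section \<open>Totally symmetric spinors\<close>

lemma two_exhaust: "i = 0 \<or> i = 1" for i :: 2
  using exhaust_2[of i] by auto

lemma UNIV_two: "(UNIV :: 2 set) = {0, 1}"
  by (rule UNIV_eq_I) (use two_exhaust in blast)

lemma sum_two: "(\<Sum>i\<in>UNIV. f i) = f 0 + f (1::2)"
  by (simp add: UNIV_two)

lemma multi_indices_0: "multi_indices 0 = {[]}"
  by (auto simp: multi_indices_def)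

lemma multi_indices_Suc:
  "multi_indices (Suc k) = (#) 0 ` multi_indices k \<union> (#) 1 ` multi_indices k"
proof -
  have "multi_indices (Suc k) = (\<Union>i\<in>UNIV. (#) i ` multi_indices k)"
    by (auto simp: multi_indices_def length_Suc_conv)
  then show ?thesis
    by (simp add: UNIV_two)
qed

lemma finite_multi_indices [simp]: "finite (multi_indices k)"
  by (induction k) (auto simp: multi_indices_0 multi_indices_Suc)

lemma count_list_le_multi_indices: "I \<in> multi_indices k \<Longrightarrow> count_list I i \<le> k"
  using count_le_length by (auto simp: multi_indices_def)

text \<open>There are \<open>k choose j\<close> lists with exactly \<open>j\<close> zeros; splitting
  a list at its head turns the induction step into Pascal's rule.\<close>

lemma sum_multi_indices:
  fixes f :: "nat \<Rightarrow> 'a :: comm_ring_1"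
  shows "(\<Sum>I\<in>multi_indices k. f (count_list I 0)) = (\<Sum>j\<le>k. of_nat (k choose j) * f j)"
proof (induction k arbitrary: f)
  case 0
  then show ?case by (simp add: multi_indices_0)
next
  case (Suc k)
  have "(\<Sum>I\<in>multi_indices (Suc k). f (count_list I 0)) =
      (\<Sum>I\<in>multi_indices k. f (Suc (count_list I 0))) + (\<Sum>I\<in>multi_indices k. f (count_list I 0))"
    unfolding multi_indices_Suc
    by (subst sum.union_disjoint) (auto simp: sum.reindex)
  also have "\<dots> = (\<Sum>j\<le>k. of_nat (k choose j) * f (Suc j)) + (\<Sum>j\<le>k. of_nat (k choose j) * f j)"
    using Suc.IH[of "\<lambda>j. f (Suc j)"] Suc.IH[of f] by simp
  also have "(\<Sum>j\<le>k. of_nat (k choose j) * f j) = (\<Sum>j\<le>Suc k. of_nat (k choose j) * f j)"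
    by (simp add: binomial_eq_0)
  also have "\<dots> = f 0 + (\<Sum>j\<le>k. of_nat (k choose Suc j) * f (Suc j))"
    by (subst sum.atMost_Suc_shift) simp
  also have "(\<Sum>j\<le>k. of_nat (k choose j) * f (Suc j)) + \<dots> =
      f 0 + (\<Sum>j\<le>k. of_nat (Suc k choose Suc j) * f (Suc j))"
    by (simp add: sum.distrib algebra_simps)
  also have "\<dots> = (\<Sum>j\<le>Suc k. of_nat (Suc k choose j) * f j)"
    by (simp add: sum.atMost_Suc_shift del: sum.atMost_Suc)
  finally show ?case .
qed

text \<open>Used twice: for the monomials in \<open>\<pi>\<close> and for products of skew
  symbols.\<close>

lemma prod_multi_index:
  fixes f :: "2 \<Rightarrow> 'a :: comm_monoid_mult"
  shows "I \<in> multi_indices k \<Longrightarrow>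
    (\<Prod>i<k. f (I ! i)) = f 0 ^ count_list I 0 * f 1 ^ (k - count_list I 0)"
proof (induction k arbitrary: I)
  case 0
  then show ?case by (simp add: multi_indices_0)
next
  case (Suc k)
  then obtain i J where J: "I = i # J" "J \<in> multi_indices k"
    by (auto simp: multi_indices_Suc)
  have "(\<Prod>i<Suc k. f (I ! i)) = f i * (\<Prod>i<k. f (J ! i))"
    by (simp add: J prod.lessThan_Suc_shift del: prod.lessThan_Suc)
  then show ?case
    using two_exhaust[of i] Suc.IH[OF J(2)] count_list_le_multi_indices[OF J(2), of 0]
    by (auto simp: J Suc_diff_le mult_ac)
qed

text \<open>In the numeral type \<open>2\<close> the map \<open>1 - i\<close> exchanges the two
  index values. \<open>flip I\<close> is the only list whose contraction with \<open>I\<close> by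
  skew symbols is nonzero.\<close>

definition flip :: "2 list \<Rightarrow> 2 list" where
  "flip = map (\<lambda>i. 1 - i)"

lemma flip_multi_indices: "I \<in> multi_indices k \<Longrightarrow> flip I \<in> multi_indices k"
  by (simp add: flip_def multi_indices_def)

lemma count_list_flip: "count_list (flip I) 0 = length I - count_list I 0"
proof (induction I)
  case (Cons i I)
  then show ?case
    using two_exhaust[of i] count_le_length[of I 0] by (auto simp: flip_def Suc_diff_le)
qed (simp add: flip_def)

text \<open>
  The binomial coefficients cancel the multiplicities with which the coefficients of a polynomial
  occur in the contraction of a totally symmetric spinor with copies of \<open>\<pi>\<close>.
\<close>

definition symmetric_spinor :: "nat \<Rightarrow> (nat \<Rightarrow> complex ^ 'd) \<Rightarrow> 2 list \<Rightarrow> complex ^ 'd" where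
  "symmetric_spinor k c I =
     inverse (of_nat (k choose count_list I 0)) *s c (count_list I 0)"

lemma homogeneous_form_symmetric_spinor:
  assumes v: "\<And>l a. v l $ a = (\<Sum>j\<le>k. c j $ a * l ^ j)"
  shows "homogeneous_form k (symmetric_spinor k c) v"
  unfolding homogeneous_form_def vec_eq_iff
proof (intro allI impI)
  fix \<pi> :: "complex ^ 2" and a
  assume nz: "\<pi> $ 1 \<noteq> 0"
  let ?f = "\<lambda>j. \<pi> $ 0 ^ j * \<pi> $ 1 ^ (k - j) * (inverse (of_nat (k choose j)) * c j $ a)"
  have "(\<Sum>I\<in>multi_indices k. (\<Prod>i<k. \<pi> $ (I ! i)) *s symmetric_spinor k c I) $ a =
      (\<Sum>I\<in>multi_indices k. ?f (count_list I 0))"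
    by (simp add: prod_multi_index[of _ _ "($) \<pi>"] symmetric_spinor_def mult.assoc)
  also have "\<dots> = (\<Sum>j\<le>k. \<pi> $ 0 ^ j * \<pi> $ 1 ^ (k - j) * c j $ a)"
    unfolding sum_multi_indices[of ?f] by (intro sum.cong) auto
  also have "\<dots> = (\<Sum>j\<le>k. \<pi> $ 1 ^ k * (c j $ a * (\<pi> $ 0 / \<pi> $ 1) ^ j))"
    using nz by (intro sum.cong) (auto simp: power_diff power_divide)
  finally show "(\<pi> $ 1 ^ k *s v (\<pi> $ 0 / \<pi> $ 1)) $ a =
      (\<Sum>I\<in>multi_indices k. (\<Prod>i<k. \<pi> $ (I ! i)) *s symmetric_spinor k c I) $ a"
    by (simp add: v sum_distrib_left)
qed

lemma skew_eq_0: "A \<noteq> 1 - B \<Longrightarrow> skew A B = 0"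
  using two_exhaust[of A] two_exhaust[of B] by (elim disjE) (simp_all add: skew_def)

lemma skew_flip: "skew (1 - A) A = (if A = 0 then - 1 else 1)"
  using two_exhaust[of A] by (elim disjE) (simp_all add: skew_def)

text \<open>Only the summand \<open>J = flip I\<close> survives; each index \<open>0\<close> of
  \<open>I\<close> contributes \<open>skew 1 0 = - 1\<close> and each index \<open>1\<close>
  contributes \<open>skew 0 1 = 1\<close>.\<close>

lemma lower_primed_eq:
  assumes I: "I \<in> multi_indices k"
  shows "lower_primed k e I = (- 1) ^ count_list I 0 *s e (flip I)"
proof -
  have zero: "(\<Prod>i<k. skew (J ! i) (I ! i)) = 0" if J: "J \<in> multi_indices k" "J \<noteq> flip I" for J
  proof -
    obtain i where "i < k" "J ! i \<noteq> 1 - I ! i"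
      using J I by (auto simp: multi_indices_def flip_def list_eq_iff_nth_eq)
    then show ?thesis
      using skew_eq_0 by auto
  qed
  have "lower_primed k e I = (\<Sum>J\<in>{flip I}. (\<Prod>i<k. skew (J ! i) (I ! i)) *s e J)"
    unfolding lower_primed_def
    by (rule sum.mono_neutral_right) (auto simp: flip_multi_indices[OF I] zero)
  also have "\<dots> = (\<Prod>i<k. skew (1 - I ! i) (I ! i)) *s e (flip I)"
    using I by (simp add: flip_def multi_indices_def)
  also have "(\<Prod>i<k. skew (1 - I ! i) (I ! i)) = (- 1) ^ count_list I 0"
    by (subst prod_multi_index[OF I, of "\<lambda>i. skew (1 - i) i"]) (simp add: skew_def)
  finally show ?thesis .
qed

text \<open>The two spinors bring two inverse binomials, equal because flipping replaces
  \<open>j\<close> by \<open>k - j\<close>; the number of lists with \<open>j\<close> zeros cancels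
  one of them.\<close>

lemma contraction_symmetric_spinor:
  "(\<Sum>I\<in>multi_indices k. lower_primed k (symmetric_spinor k c) I $ a * symmetric_spinor k d I $ b) =
     (\<Sum>j\<le>k. (- 1) ^ j / of_nat (k choose j) * c (k - j) $ a * d j $ b)"
proof -
  let ?f = "\<lambda>j. (- 1) ^ j * (inverse (of_nat (k choose j)) * c (k - j) $ a) *
      (inverse (of_nat (k choose j)) * d j $ b)"
  have "(\<Sum>I\<in>multi_indices k. lower_primed k (symmetric_spinor k c) I $ a * symmetric_spinor k d I $ b) =
      (\<Sum>I\<in>multi_indices k. ?f (count_list I 0))"
  proof (intro sum.cong refl)
    fix I assume I: "I \<in> multi_indices k"
    then have "count_list (flip I) 0 = k - count_list I 0"
      by (simp add: count_list_flip multi_indices_def)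
    moreover have "k choose (k - count_list I 0) = k choose count_list I 0"
      using count_list_le_multi_indices[OF I] binomial_symmetric by metis
    ultimately show "lower_primed k (symmetric_spinor k c) I $ a * symmetric_spinor k d I $ b =
      ?f (count_list I 0)"
      by (simp add: lower_primed_eq[OF I] symmetric_spinor_def)
  qed
  also have "\<dots> = (\<Sum>j\<le>k. (- 1) ^ j / of_nat (k choose j) * c (k - j) $ a * d j $ b)"
    unfolding sum_multi_indices[of ?f] by (intro sum.cong) (auto simp: divide_simps)
  finally show ?thesis .
qed

lemma spatial_metric_symmetric_spinor:
  "spatial_metric k (symmetric_spinor k c) $ a $ b =
     (\<Sum>j\<le>k. (- 1) ^ j / of_nat (k choose j) * c (k - j) $ a * c j $ b)"
  by (simp add: spatial_metric_def contraction_symmetric_spinor)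

text \<open>The sum over the lowered unprimed index collapses to \<open>B = 1 - A\<close>. A single
  sum over pairs \<open>(A, j)\<close> exhibits the metric as a monomial form whose permutation
  sends \<open>(A, j)\<close> to \<open>(1 - A, k - j)\<close>.\<close>

lemma frame_metric_symmetric_spinor:
  "frame_metric k (\<lambda>A. symmetric_spinor k (c A)) $ a $ b =
     (\<Sum>(A, j)\<in>UNIV \<times> {..k}.
        skew (1 - A) A * (- 1) ^ j / of_nat (k choose j) * c (1 - A) (k - j) $ a * c A j $ b)"
proof -
  have "(\<Sum>B\<in>UNIV. skew B A * lower_primed k (symmetric_spinor k (c B)) I $ a) =
      skew (1 - A) A * lower_primed k (symmetric_spinor k (c (1 - A))) I $ a" for A I
    using two_exhaust[of A] by (elim disjE) (simp_all add: sum_two skew_def)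
  then have "frame_metric k (\<lambda>A. symmetric_spinor k (c A)) $ a $ b =
      (\<Sum>A\<in>UNIV. skew (1 - A) A * (\<Sum>I\<in>multi_indices k.
        lower_primed k (symmetric_spinor k (c (1 - A))) I $ a * symmetric_spinor k (c A) I $ b))"
    by (simp add: frame_metric_def sum_distrib_left mult.assoc)
  then show ?thesis
    by (simp add: contraction_symmetric_spinor sum.cartesian_product[symmetric] sum_distrib_left
        mult.assoc)
qed

text \<open>Exchanging \<open>a\<close> and \<open>b\<close> amounts to replacing \<open>j\<close>
  by \<open>k - j\<close>, which keeps the sign for even \<open>k\<close>.\<close>

lemma transpose_spatial_metric:
  assumes "even k"
  shows "transpose (spatial_metric k (symmetric_spinor k c)) = spatial_metric k (symmetric_spinor k c)"
proof -
  have "(\<Sum>j\<le>k. (- 1) ^ j / of_nat (k choose j) * c (k - j) $ a * c j $ b) =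
      (\<Sum>j\<le>k. (- 1) ^ j / of_nat (k choose j) * c (k - j) $ b * c j $ a)" for a b
  proof (rule sum.reindex_bij_witness[of _ "\<lambda>j. k - j" "\<lambda>j. k - j"])
    fix j assume "j \<in> {..k}"
    then have j: "j \<le> k" by simp
    then have "even (k - j) \<longleftrightarrow> even j"
      using assms by simp
    with j show "(- 1) ^ (k - j) / of_nat (k choose (k - j)) * c (k - (k - j)) $ b * c (k - j) $ a =
        (- 1) ^ j / of_nat (k choose j) * c (k - j) $ a * c j $ b"
      by (simp add: binomial_symmetric[OF j] minus_one_power_iff)
  qed auto
  then show ?thesis
    by (simp add: vec_eq_iff transpose_def spatial_metric_symmetric_spinor)
qed

text \<open>For odd \<open>k\<close> the substitution of \<open>k - j\<close> for \<open>j\<close>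
  reverses the sign, and so does exchanging the unprimed indices; the two signs cancel.\<close>

lemma transpose_frame_metric:
  assumes "odd k"
  shows "transpose (frame_metric k (\<lambda>A. symmetric_spinor k (c A))) =
    frame_metric k (\<lambda>A. symmetric_spinor k (c A))"
proof -
  have "(\<Sum>(A, j)\<in>UNIV \<times> {..k}.
        skew (1 - A) A * (- 1) ^ j / of_nat (k choose j) * c (1 - A) (k - j) $ a * c A j $ b) =
      (\<Sum>(A, j)\<in>UNIV \<times> {..k}.
        skew (1 - A) A * (- 1) ^ j / of_nat (k choose j) * c (1 - A) (k - j) $ b * c A j $ a)" for a b
  proof (rule sum.reindex_bij_witness[of _ "\<lambda>(A, j). (1 - A, k - j)" "\<lambda>(A, j). (1 - A, k - j)"],
      goal_cases)
    \<comment> \<open>The fifth goal of the reindexing rule is the equality of the summands; the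
      others say that the substitution is an involution of the index set.\<close>
    case (5 p)
    obtain A j where p: "p = (A, j)" "j \<le> k"
      using 5 by auto
    have "(- 1 :: complex) ^ (k - j) = - ((- 1) ^ j)"
      using assms p by (auto simp: minus_one_power_iff)
    moreover have "skew (1 - (1 - A)) (1 - A) = - skew (1 - A) A"
      using two_exhaust[of A] by (elim disjE) (simp_all add: skew_def)
    ultimately show ?case
      using p by (simp add: binomial_symmetric[OF p(2)])
  qed auto
  then show ?thesis
    by (simp add: vec_eq_iff transpose_def frame_metric_symmetric_spinor)
qed

lemma symmetric_one_forms_symmetric_spinor:
  assumes "\<And>j a. j \<le> k \<Longrightarrow> holomorphic_vec (\<lambda>x. c x j $ a)"
  shows "symmetric_one_forms k (\<lambda>x. symmetric_spinor k (c x))"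
  unfolding symmetric_one_forms_def
proof (intro conjI ballI allI impI)
  fix I assume "I \<in> multi_indices k"
  then show "holomorphic_one_form (\<lambda>x. symmetric_spinor k (c x) I)"
    unfolding holomorphic_one_form_def symmetric_spinor_def vector_smult_component
    by (intro allI hol.mult hol.const assms count_list_le_multi_indices)
next
  fix x and I J :: "2 list"
  assume "mset I = mset J"
  then show "symmetric_spinor k (c x) I = symmetric_spinor k (c x) J"
    by (metis count_mset symmetric_spinor_def)
qed

section \<open>Bases and dual bases\<close>

text \<open>The covectors form the rows of a matrix, square by the cardinality assumption. Trivial
  kernel gives a left inverse, hence a two-sided one, and the columns of the inverse are the dual
  vectors.\<close>

lemma dual_basis:
  fixes c :: "'p \<Rightarrow> complex ^ 'd"
  assumes "finite P" "card P = CARD('d)"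
    and inj: "\<And>V. (\<And>p. p \<in> P \<Longrightarrow> pairing (c p) V = 0) \<Longrightarrow> V = 0"
  obtains W where "\<And>p q. p \<in> P \<Longrightarrow> q \<in> P \<Longrightarrow> pairing (c p) (W q) = (if p = q then 1 else 0)"
proof -
  obtain f where f: "bij_betw f (UNIV :: 'd set) P"
    using assms finite_same_card_bij by (metis finite_class.finite_UNIV)
  define C :: "complex ^ 'd ^ 'd" where "C = (\<chi> i. c (f i))"
  have "V = 0" if "C *v V = 0" for V
  proof (rule inj)
    fix p assume "p \<in> P"
    then obtain i where "p = f i"
      using f by (auto simp: bij_betw_def)
    with that show "pairing (c p) V = 0"
      by (auto simp: C_def pairing_def matrix_vector_mult_def vec_eq_iff)
  qed
  then obtain B where "B ** C = mat 1"
    using matrix_left_invertible_ker by blast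
  then have B: "C ** B = mat 1"
    using matrix_left_right_inverse by blast
  define W where "W p = column (inv f p) B" for p
  have "pairing (c p) (W q) = (if p = q then 1 else 0)" if pq: "p \<in> P" "q \<in> P" for p q
  proof -
    obtain i j where "p = f i" "q = f j"
      using f pq by (auto simp: bij_betw_def)
    moreover have "inj f"
      using f by (simp add: bij_betw_def)
    moreover have "pairing (c (f i)) (column j B) = (C ** B) $ i $ j"
      by (simp add: C_def pairing_def matrix_matrix_mult_def column_def)
    ultimately show ?thesis
      by (auto simp: W_def B mat_def inj_eq)
  qed
  with that show thesis by blast
qed

lemma pairing_add: "pairing \<alpha> (U + V) = pairing \<alpha> U + pairing \<alpha> V"
  and pairing_scale: "pairing \<alpha> (k *s V) = k * pairing \<alpha> V"
  and pairing_scale_left: "pairing (k *s \<alpha>) V = k * pairing \<alpha> V"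
  by (simp_all add: pairing_def algebra_simps sum.distrib sum_subtractf sum_distrib_left)

lemma monomial_form_mult:
  "((\<chi> a b. \<Sum>p\<in>P. s p * c (\<sigma> p) $ a * c p $ b) *v V) $ a =
    (\<Sum>p\<in>P. s p * c (\<sigma> p) $ a * pairing (c p) V)"
  unfolding pairing_def matrix_vector_mult_def sum_distrib_left
  by (simp add: sum_distrib_right sum.swap[of _ UNIV P] mult.assoc)

text \<open>Contracting \<open>?M *v V\<close> with the vector dual to \<open>c (\<sigma> q)\<close>
  isolates \<open>s q * pairing (c q) V\<close>, because \<open>\<sigma>\<close> is injective. So a
  vector in the kernel is annihilated by the whole coframe.\<close>

lemma invertible_monomial_form:
  fixes c :: "'p \<Rightarrow> complex ^ 'd"
  assumes P: "finite P" "card P = CARD('d)"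
    and inj: "\<And>V. (\<And>p. p \<in> P \<Longrightarrow> pairing (c p) V = 0) \<Longrightarrow> V = 0"
    and \<sigma>: "\<sigma> ` P \<subseteq> P" "inj_on \<sigma> P" and s: "\<And>p. p \<in> P \<Longrightarrow> s p \<noteq> 0"
  shows "invertible (\<chi> a b. \<Sum>p\<in>P. s p * c (\<sigma> p) $ a * c p $ b)" (is "invertible ?M")
proof -
  obtain W where W: "\<And>p q. p \<in> P \<Longrightarrow> q \<in> P \<Longrightarrow> pairing (c p) (W q) = (if p = q then 1 else 0)"
    using dual_basis[OF P inj] by blast
  have "V = 0" if V: "?M *v V = 0" for V
  proof (rule inj)
    fix q assume q: "q \<in> P"
    have "0 = (\<Sum>a\<in>UNIV. (?M *v V) $ a * W (\<sigma> q) $ a)"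
      by (simp add: V)
    also have "\<dots> = (\<Sum>p\<in>P. s p * pairing (c p) V * pairing (c (\<sigma> p)) (W (\<sigma> q)))"
      unfolding monomial_form_mult pairing_def[of "c (\<sigma> _)"] sum_distrib_left sum_distrib_right
      by (subst sum.swap) (simp add: mult_ac)
    also have "\<dots> = (\<Sum>p\<in>P. if p = q then s q * pairing (c q) V else 0)"
    proof (intro sum.cong refl)
      fix p assume p: "p \<in> P"
      have "\<sigma> p \<in> P" "\<sigma> q \<in> P" "\<sigma> p = \<sigma> q \<longleftrightarrow> p = q"
        using \<sigma> p q by (auto simp: inj_on_def)
      then show "s p * pairing (c p) V * pairing (c (\<sigma> p)) (W (\<sigma> q)) =
          (if p = q then s q * pairing (c q) V else 0)"
        by (simp add: W)
    qed
    also have "\<dots> = s q * pairing (c q) V"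
      using q P by simp
    finally show "pairing (c q) V = 0"
      using s[OF q] by simp
  qed
  then show ?thesis
    unfolding invertible_left_inverse using matrix_left_invertible_ker by blast
qed

section \<open>Galilean structures from a degenerate covariant metric\<close>

definition outer :: "complex ^ 'd \<Rightarrow> complex ^ 'd \<Rightarrow> complex ^ 'd ^ 'd" where
  "outer u v = (\<chi> a b. u $ a * v $ b)"

lemma pairing_commute: "pairing u v = pairing v u"
  by (simp add: pairing_def mult.commute)

lemma outer_mult_vec: "outer u v *v w = pairing v w *s u"
  by (simp add: outer_def pairing_def matrix_vector_mult_def vec_eq_iff sum_distrib_left mult_ac)

lemma mult_outer: "A ** outer u v = outer (A *v u) v"
  by (simp add: outer_def matrix_matrix_mult_def matrix_vector_mult_def vec_eq_iff
      sum_distrib_right mult.assoc)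

lemma outer_mult: "outer u v ** A = outer u (transpose A *v v)"
  by (simp add: outer_def matrix_matrix_mult_def matrix_vector_mult_def transpose_def vec_eq_iff
      sum_distrib_left mult_ac)

lemma transpose_outer: "transpose (outer u v) = outer v u"
  by (simp add: outer_def transpose_def vec_eq_iff mult.commute)

lemma transpose_diff: "transpose (A - B) = transpose A - transpose (B :: complex ^ 'n ^ 'm)"
  by (simp add: transpose_def vec_eq_iff)

lemma matrix_mult_diff_left: "(A - B) ** C = A ** C - B ** (C :: complex ^ 'n ^ 'm)"
  by (simp add: matrix_matrix_mult_def vec_eq_iff left_diff_distrib sum_subtractf)

lemma matrix_mult_diff_right: "A ** (B - C) = A ** B - A ** (C :: complex ^ 'n ^ 'm)"
  by (simp add: matrix_matrix_mult_def vec_eq_iff right_diff_distrib sum_subtractf)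

lemma mat_minus_outer: "(\<chi> a c. (if a = c then 1 else 0) - U $ a * \<theta> $ c) = mat 1 - outer U \<theta>"
  by (simp add: mat_def outer_def vec_eq_iff)

lemma raised_metric_mult:
  assumes "raised_metric q \<theta> U h"
  shows "h ** q = mat 1 - outer U \<theta>"
  using assms by (simp add: raised_metric_def mat_minus_outer)

lemma raised_metric_mult':
  assumes "raised_metric q \<theta> U h" and q: "transpose q = q"
  shows "q ** h = mat 1 - outer \<theta> U"
proof -
  have "transpose h = h"
    using assms(1) by (simp add: raised_metric_def)
  then have "q ** h = transpose (h ** q)"
    by (simp only: matrix_transpose_mul q)
  then show ?thesis
    by (simp add: raised_metric_mult[OF assms(1)] transpose_diff transpose_outer)
qed

text \<open>The product \<open>k ** q ** h\<close> is evaluated with either bracketing: one gives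
  \<open>k\<close>, the other \<open>h\<close>, since both tensors annihilate
  \<open>\<theta>\<close>.\<close>

lemma raised_metric_unique:
  assumes "raised_metric q \<theta> U h" "raised_metric q \<theta> U k" and q: "transpose q = q"
  shows "k = h"
proof -
  have "k ** (q ** h) = (k ** q) ** h"
    by (simp add: matrix_mul_assoc)
  then have "k - outer (k *v \<theta>) U = h - outer U (transpose h *v \<theta>)"
    unfolding raised_metric_mult'[OF assms(1) q] raised_metric_mult[OF assms(2)]
    by (simp add: matrix_mult_diff_left matrix_mult_diff_right mult_outer outer_mult)
  moreover have "transpose h = h" "h *v \<theta> = 0" "k *v \<theta> = 0"
    using assms by (simp_all add: raised_metric_def)
  moreover have "outer 0 U = 0" "outer U 0 = 0"
    by (simp_all add: outer_def vec_eq_iff)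
  ultimately show ?thesis
    by simp
qed

text \<open>If \<open>h *v \<alpha> = 0\<close>, then also \<open>q ** h\<close> annihilates
  \<open>\<alpha>\<close>, and \<open>q ** h\<close> is the identity minus
  \<open>outer \<theta> U\<close>, so \<open>\<alpha>\<close> is a multiple of
  \<open>\<theta>\<close>.\<close>

lemma kernel_raised_metric:
  assumes h: "raised_metric q \<theta> U h" and q: "transpose q = q"
  shows "{\<alpha>. h *v \<alpha> = 0} = range (\<lambda>k. k *s \<theta>)"
proof (intro equalityI subsetI)
  fix \<alpha> assume "\<alpha> \<in> {\<alpha>. h *v \<alpha> = 0}"
  then have "(q ** h) *v \<alpha> = 0"
    by (simp flip: matrix_vector_mul_assoc)
  then have "\<alpha> = pairing U \<alpha> *s \<theta>"
    unfolding raised_metric_mult'[OF h q]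
    by (simp add: matrix_vector_mult_diff_rdistrib outer_mult_vec)
  then show "\<alpha> \<in> range (\<lambda>k. k *s \<theta>)"
    by blast
qed (use h in \<open>auto simp: raised_metric_def vec.scale\<close>)

text \<open>The rows of \<open>h\<close> together with \<open>U\<close> span everything, because
  \<open>V = h *v (q *v V) + pairing \<theta> V *s U\<close>. The rows alone miss \<open>U\<close>:
  they are annihilated by \<open>\<theta>\<close>, while \<open>pairing \<theta> U = 1\<close>.
  Hence exactly one dimension is lost.\<close>

lemma rank_raised_metric:
  fixes h :: "complex ^ 'd ^ 'd"
  assumes h: "raised_metric q \<theta> U h" and U: "pairing \<theta> U = 1"
  shows "rank h = CARD('d) - 1"
proof -
  have "transpose h = h"
    using h by (simp add: raised_metric_def)
  then have sym: "h $ i $ j = h $ j $ i" for i j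
    by (simp add: transpose_def vec_eq_iff)
  have row: "row i h \<in> vec.span (rows h)" for i
    by (intro vec.span_base) (auto simp: rows_def)
  have "V \<in> vec.span (insert U (rows h))" for V
  proof -
    have "(h ** q) *v V = V - pairing \<theta> V *s U"
      by (simp add: raised_metric_mult[OF h] matrix_vector_mult_diff_rdistrib outer_mult_vec)
    then have "V = h *v (q *v V) + pairing \<theta> V *s U"
      by (simp add: matrix_vector_mul_assoc)
    also have "h *v (q *v V) = (\<Sum>i\<in>UNIV. (q *v V) $ i *s row i h)"
      unfolding matrix_mult_sum by (intro sum.cong) (auto simp: column_def row_def sym)
    finally have V: "V = (\<Sum>i\<in>UNIV. (q *v V) $ i *s row i h) + pairing \<theta> V *s U" .
    have "row i h \<in> vec.span (insert U (rows h))" for i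
      using row vec.span_mono[of "rows h" "insert U (rows h)"] by blast
    moreover have "U \<in> vec.span (insert U (rows h))"
      by (intro vec.span_base) simp
    ultimately show ?thesis
      by (subst V) (intro vec.span_add vec.span_sum vec.span_scale)
  qed
  then have "vec.span (insert U (rows h)) = UNIV"
    by blast
  then have dim: "vec.dim (insert U (rows h)) = CARD('d)"
    by (metis vec.dim_span vec_dim_card)
  have "U \<notin> vec.span (rows h)"
  proof
    assume "U \<in> vec.span (rows h)"
    moreover have "vec.span (rows h) \<subseteq> {V. pairing \<theta> V = 0}"
    proof (rule vec.span_minimal)
      show "rows h \<subseteq> {V. pairing \<theta> V = 0}"
      proof
        fix r assume "r \<in> rows h"
        then obtain i where "r = row i h"
          by (auto simp: rows_def)
        moreover have "(h *v \<theta>) $ i = 0"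
          using h by (simp add: raised_metric_def)
        ultimately show "r \<in> {V. pairing \<theta> V = 0}"
          by (simp add: pairing_def row_def matrix_vector_mult_def mult.commute)
      qed
    qed (auto simp: vec.subspace_def pairing_add pairing_scale, simp add: pairing_def)
    ultimately show False
      using U by auto
  qed
  then show ?thesis
    using dim by (simp add: row_rank_def_gen vec.dim_insert)
qed

text \<open>Expressing \<open>U\<close> and \<open>h\<close> through an inverse matrix makes them
  visibly holomorphic in \<open>x\<close>, which a pointwise choice would not.\<close>

lemma induces_galilean_structureI:
  fixes q :: "complex ^ 'd \<Rightarrow> complex ^ 'd ^ 'd"
  assumes q: "symmetric_tensor_field q" and \<theta>: "closed_one_form \<theta>"
    and inv: "\<And>x. invertible (q x + outer (\<theta> x) (\<theta> x))"
    and obs: "\<And>x. \<exists>V. field_of_observers (q x) (\<theta> x) V"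
  shows "induces_galilean_structure q \<theta>"
proof -
  define B where "B x = matrix_inv (q x + outer (\<theta> x) (\<theta> x))" for x
  define U where "U x = B x *v \<theta> x" for x
  define h where "h x = B x - outer (U x) (U x)" for x
  have sym: "transpose (q x) = q x" for x
    using q by (simp add: symmetric_tensor_field_def)
  have B: "(q x + outer (\<theta> x) (\<theta> x)) ** B x = mat 1" "B x ** (q x + outer (\<theta> x) (\<theta> x)) = mat 1" for x
    using matrix_inv_mult[OF inv] by (auto simp: B_def)
  \<comment> \<open>Every observer solves
    \<open>(q x + outer (\<theta> x) (\<theta> x)) *v V = \<theta> x\<close>, so uniqueness is
    proved first; then \<open>obs\<close> shows that \<open>U x\<close> itself is an
    observer.\<close>
  have U_unique: "V = U x" if "field_of_observers (q x) (\<theta> x) V" for x V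
  proof -
    have "(q x + outer (\<theta> x) (\<theta> x)) *v V = \<theta> x"
      using that by (simp add: field_of_observers_def matrix_vector_mult_add_rdistrib outer_mult_vec)
    then have "U x = (B x ** (q x + outer (\<theta> x) (\<theta> x))) *v V"
      by (simp add: U_def flip: matrix_vector_mul_assoc)
    then show ?thesis
      by (simp add: B)
  qed
  then have U: "field_of_observers (q x) (\<theta> x) (U x)" for x
    using obs by metis
  have B_sym: "transpose (B x) = B x" for x
  proof -
    have "transpose (q x + outer (\<theta> x) (\<theta> x)) = q x + outer (\<theta> x) (\<theta> x)"
      using sym[of x] by (auto simp: transpose_def vec_eq_iff outer_def mult.commute)
    then have "transpose (B x) ** (q x + outer (\<theta> x) (\<theta> x)) = mat 1"
      using arg_cong[OF B(1)[of x], of transpose] by (simp add: matrix_transpose_mul)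
    then have "transpose (B x) ** ((q x + outer (\<theta> x) (\<theta> x)) ** B x) = B x"
      by (simp add: matrix_mul_assoc)
    then show ?thesis
      by (simp add: B)
  qed
  have h: "raised_metric (q x) (\<theta> x) (U x) (h x)" for x
    unfolding raised_metric_def mat_minus_outer
  proof (intro conjI)
    show "transpose (h x) = h x"
      by (simp add: h_def transpose_diff transpose_outer B_sym)
    have "B x ** q x = B x ** (q x + outer (\<theta> x) (\<theta> x)) - B x ** outer (\<theta> x) (\<theta> x)"
      by (simp flip: matrix_mult_diff_right)
    then have "B x ** q x = mat 1 - outer (U x) (\<theta> x)"
      by (simp add: B mult_outer U_def)
    \<comment> \<open>By symmetry of \<open>q x\<close> the product is
      \<open>outer (U x) (q x *v U x)\<close>, and \<open>q x\<close> annihilates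
      \<open>U x\<close>.\<close>
    moreover have "outer (U x) (U x) ** q x = 0"
      using U[of x] by (simp add: outer_mult sym field_of_observers_def) (simp add: outer_def vec_eq_iff)
    ultimately show "h x ** q x = mat 1 - outer (U x) (\<theta> x)"
      by (simp add: h_def matrix_mult_diff_left)
    show "h x *v \<theta> x = 0"
      using U[of x]
      by (simp add: h_def matrix_vector_mult_diff_rdistrib outer_mult_vec field_of_observers_def
          pairing_commute[of "U x"]) (simp add: U_def)
  qed
  have \<theta>_hol: "holomorphic_vec (\<lambda>x. \<theta> x $ a)" for a
    using \<theta> by (simp add: closed_one_form_def holomorphic_one_form_def)
  have B_hol: "holomorphic_vec (\<lambda>x. B x $ a $ b)" for a b
    unfolding B_def
  proof (rule hol.matrix_inv[OF _ inv])
    fix i j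
    show "holomorphic_vec (\<lambda>x. (q x + outer (\<theta> x) (\<theta> x)) $ i $ j)"
      using q by (auto simp: outer_def symmetric_tensor_field_def intro!: hol.add hol.mult \<theta>_hol)
  qed
  have U_hol: "holomorphic_vec (\<lambda>x. U x $ a)" for a
    unfolding U_def matrix_vector_mult_def by (auto intro!: hol.sum hol.mult B_hol \<theta>_hol)
  have "galilean_structure h \<theta>"
    unfolding galilean_structure_def
  proof (intro conjI allI \<theta>)
    show "symmetric_tensor_field h"
      unfolding symmetric_tensor_field_def
    proof (intro conjI allI)
      fix a b
      show "holomorphic_vec (\<lambda>x. h x $ a $ b)"
        by (auto simp: h_def outer_def intro!: hol.diff hol.mult B_hol U_hol)
    next
      fix x
      show "transpose (h x) = h x"
        using h by (simp add: raised_metric_def)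
    qed
    show "rank (h x) = CARD('d) - 1" for x
      using rank_raised_metric[OF h] U by (simp add: field_of_observers_def)
    show "{\<alpha>. h x *v \<alpha> = 0} = range (\<lambda>k. k *s \<theta> x)" for x
      by (rule kernel_raised_metric[OF h sym])
  qed
  then show ?thesis
    unfolding induces_galilean_structure_def
    using U U_unique h raised_metric_unique[OF h _ sym] by blast
qed

section \<open>The bundles and their global sections\<close>

text \<open>The value \<open>0\<close> at \<open>Infty\<close> encodes the absent term, so finite
  and infinite parameters share one transition matrix and one description of sections.\<close>

definition coupling :: "bundle_parameter \<Rightarrow> complex" where
  "coupling c = (case c of Fin a \<Rightarrow> 1 / a | Infty \<Rightarrow> 0)"

definition bundle_matrix :: "nat \<Rightarrow> bundle_parameter \<Rightarrow> complex \<Rightarrow> complex ^ 2 ^ 2" where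
  "bundle_matrix n c l = (\<chi> i j.
     if i = 0 then (if j = 0 then 1 else coupling c / l ^ (2 * n - 1))
     else (if j = 0 then 0 else inverse (l ^ (4 * n - 2))))"

lemma bundle_matrix_nth [simp]:
  "bundle_matrix n c l $ 0 $ 0 = 1" "bundle_matrix n c l $ 0 $ 1 = coupling c / l ^ (2 * n - 1)"
  "bundle_matrix n c l $ 1 $ 0 = 0" "bundle_matrix n c l $ 1 $ 1 = inverse (l ^ (4 * n - 2))"
  by (simp_all add: bundle_matrix_def)

lemma forall_two: "(\<forall>i::2. P i) \<longleftrightarrow> P 0 \<and> P 1"
  using two_exhaust by metis

lemma mult_vec_two: "((M :: complex ^ 2 ^ 2) *v w) $ i = M $ i $ 0 * w $ 0 + M $ i $ 1 * w $ 1"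
  by (simp add: matrix_vector_mult_def sum_two)

lemma mult_two:
  "((M :: complex ^ 2 ^ 2) ** N) $ i $ j = M $ i $ 0 * N $ 0 $ j + M $ i $ 1 * N $ 1 $ j"
  by (simp add: matrix_matrix_mult_def sum_two)

lemma patching_eq:
  assumes "n > 0"
  shows "patching n (4 * n) c l w = bundle_matrix n c l *v w"
proof -
  have e: "2 - int (4 * n) = - int (4 * n - 2)"
    using assms by simp
  show ?thesis
    unfolding vec_eq_iff forall_two mult_vec_two patching_def e power_int_minus
    by (simp add: coupling_def split: bundle_parameter.split)
qed

text \<open>Everything differentiated here is affine along the coordinate axes, so no further
  calculus is required.\<close>

lemma partial_affine:
  assumes "\<And>z. f (x + axis a z) = \<alpha> + z * \<beta>"
  shows "partial a f x = \<beta>"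
proof -
  have "((\<lambda>z. \<alpha> + z * \<beta>) has_field_derivative \<beta>) (at 0)"
    by (auto intro!: derivative_eq_intros)
  then show ?thesis
    unfolding partial_def assms by (rule DERIV_imp_deriv)
qed

lemma normal_patching_eq:
  assumes "n > 0"
  shows "normal_patching n (4 * n) c X = bundle_matrix n c"
proof -
  have "partial \<nu> (\<lambda>u. (M *v u) $ \<mu>) w = M $ \<mu> $ \<nu>" for M :: "complex ^ 2 ^ 2" and w \<mu> \<nu>
  proof (rule partial_affine)
    fix z
    have "(M *v axis \<nu> z) $ \<mu> = z * M $ \<mu> $ \<nu>"
      using two_exhaust[of \<nu>] by (elim disjE) (simp_all add: mult_vec_two axis_def)
    then show "(M *v (w + axis \<nu> z)) $ \<mu> = (M *v w) $ \<mu> + z * M $ \<mu> $ \<nu>"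
      by (simp add: matrix_vector_right_distrib)
  qed
  then show ?thesis
    by (simp add: normal_patching_def patching_eq[OF assms] fun_eq_iff vec_eq_iff)
qed

lemma mem_global_sections:
  assumes "n > 0"
  shows "(w, w') \<in> global_sections n (4 * n) c \<longleftrightarrow>
    (\<forall>\<mu>. (\<lambda>l. w l $ \<mu>) holomorphic_on UNIV) \<and> (\<forall>\<mu>. (\<lambda>l. w' l $ \<mu>) holomorphic_on UNIV) \<and>
    (\<forall>l. l \<noteq> 0 \<longrightarrow> w' (inverse l) = bundle_matrix n c l *v w l)"
  by (simp add: global_sections_def patching_eq[OF assms])

text \<open>The patching determines the second representative away from its origin, and continuity
  determines it there.\<close>

lemma global_sections_eqI:
  assumes "n > 0" "X \<in> global_sections n (4 * n) c" "Y \<in> global_sections n (4 * n) c"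
    and eq: "fst X = fst Y"
  shows "X = Y"
proof -
  obtain w w' v' where X: "X = (w, w')" and Y: "Y = (w, v')"
    using eq by (metis prod.collapse)
  note w = assms(2)[unfolded X mem_global_sections[OF assms(1)]]
  note v = assms(3)[unfolded Y mem_global_sections[OF assms(1)]]
  have "(\<lambda>m. w' m $ \<mu>) = (\<lambda>m. v' m $ \<mu>)" for \<mu>
  proof (rule entire_eq_except_zero)
    fix m :: complex assume "m \<noteq> 0"
    then have "w' (inverse (inverse m)) = v' (inverse (inverse m))"
      using w v by (metis inverse_nonzero_iff_nonzero)
    then show "w' m $ \<mu> = v' m $ \<mu>"
      by simp
  qed (use w v in auto)
  then have "w' = v'"
    by (simp add: fun_eq_iff vec_eq_iff)
  then show ?thesis
    by (simp add: X Y)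
qed

text \<open>The second component is an arbitrary polynomial of degree at most
  \<open>4 * n - 2\<close>. Divided by \<open>\<lambda> ^ (2 * n - 1)\<close> it has positive powers
  of \<lambda>, which the first component must cancel, and nonpositive powers, which are holomorphic
  at infinity and stay in the second patch. The constant \<open>t\<close> is the remaining
  freedom.\<close>

definition standard_section :: "nat \<Rightarrow> bundle_parameter \<Rightarrow> complex \<Rightarrow> (nat \<Rightarrow> complex) \<Rightarrow> curve" where
  "standard_section n c t s =
     (\<lambda>l. \<chi> \<mu>. if \<mu> = 0 then t - coupling c * (\<Sum>j\<in>{1..2 * n - 1}. s (2 * n - 1 + j) * l ^ j)
               else (\<Sum>k\<le>4 * n - 2. s k * l ^ k),
      \<lambda>m. \<chi> \<mu>. if \<mu> = 0 then t + coupling c * (\<Sum>k\<le>2 * n - 1. s k * m ^ (2 * n - 1 - k))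
               else (\<Sum>k\<le>4 * n - 2. s k * m ^ (4 * n - 2 - k)))"

lemma inverse_power_diff:
  fixes l :: complex
  assumes "l \<noteq> 0" "k \<le> K"
  shows "l ^ k / l ^ K = inverse l ^ (K - k)"
proof -
  have "l ^ K = l ^ k * l ^ (K - k)"
    using assms by (simp flip: power_add)
  then show ?thesis
    using assms by (simp add: power_inverse divide_simps)
qed

lemma split_polynomial:
  fixes l :: complex
  assumes "n > 0" "l \<noteq> 0"
  shows "(\<Sum>k\<le>4 * n - 2. s k * l ^ k) / l ^ (2 * n - 1) =
    (\<Sum>k\<le>2 * n - 1. s k * inverse l ^ (2 * n - 1 - k)) +
    (\<Sum>j\<in>{1..2 * n - 1}. s (2 * n - 1 + j) * l ^ j)"
proof -
  let ?m = "2 * n - 1"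
  \<comment> \<open>As \<open>4 * n - 2 = ?m + ?m\<close>, the powers above \<open>?m\<close> are
    \<open>?m + j\<close> with \<open>j\<close> from \<open>1\<close> to \<open>?m\<close>; the
    power \<open>?m\<close> itself goes with the lower half.\<close>
  have "(\<Sum>k\<le>4 * n - 2. s k * l ^ k) = (\<Sum>k\<in>{..?m} \<union> {1 + ?m..?m + ?m}. s k * l ^ k)"
    using assms(1) by (intro sum.cong) auto
  also have "\<dots> = (\<Sum>k\<le>?m. s k * l ^ k) + (\<Sum>k\<in>{1 + ?m..?m + ?m}. s k * l ^ k)"
    by (rule sum.union_disjoint) auto
  also have "(\<Sum>k\<in>{1 + ?m..?m + ?m}. s k * l ^ k) = (\<Sum>j\<in>{1..?m}. s (?m + j) * l ^ (?m + j))"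
    unfolding sum.shift_bounds_cl_nat_ivl by (simp add: add.commute)
  finally have "(\<Sum>k\<le>4 * n - 2. s k * l ^ k) / l ^ ?m =
      (\<Sum>k\<le>?m. s k * (l ^ k / l ^ ?m)) + (\<Sum>j\<in>{1..?m}. s (?m + j) * l ^ j)"
    using assms(2) by (simp add: add_divide_distrib sum_divide_distrib power_add)
  then show ?thesis
    using assms(2) by (simp add: inverse_power_diff)
qed

lemma standard_section_mem:
  assumes "n > 0"
  shows "standard_section n c t s \<in> global_sections n (4 * n) c"
  unfolding standard_section_def mem_global_sections[OF assms]
proof (intro conjI allI impI)
  fix l :: complex assume l: "l \<noteq> 0"
  have "(\<Sum>k\<le>4 * n - 2. s k * l ^ k) / l ^ (4 * n - 2) =
      (\<Sum>k\<le>4 * n - 2. s k * inverse l ^ (4 * n - 2 - k))"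
    unfolding sum_divide_distrib times_divide_eq_right[symmetric]
    by (intro sum.cong) (auto simp: inverse_power_diff[OF l])
  then show "(\<chi> \<mu>. if \<mu> = 0 then t + coupling c * (\<Sum>k\<le>2 * n - 1. s k * inverse l ^ (2 * n - 1 - k))
               else (\<Sum>k\<le>4 * n - 2. s k * inverse l ^ (4 * n - 2 - k))) =
    bundle_matrix n c l *v
      (\<chi> \<mu>. if \<mu> = 0 then t - coupling c * (\<Sum>j\<in>{1..2 * n - 1}. s (2 * n - 1 + j) * l ^ j)
            else (\<Sum>k\<le>4 * n - 2. s k * l ^ k))"
    unfolding vec_eq_iff forall_two mult_vec_two
    using split_polynomial[OF assms l, of s]
    by (simp add: divide_inverse mult.commute mult.left_commute algebra_simps)
next
  show "(\<lambda>l. (\<chi> \<mu>. if \<mu> = 0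
      then t - coupling c * (\<Sum>j\<in>{1..2 * n - 1}. s (2 * n - 1 + j) * l ^ j)
      else (\<Sum>k\<le>4 * n - 2. s k * l ^ k)) $ \<mu>) holomorphic_on UNIV" for \<mu> :: 2
    by (cases "\<mu> = 0") (auto intro!: holomorphic_intros)
  show "(\<lambda>m. (\<chi> \<mu>. if \<mu> = 0
      then t + coupling c * (\<Sum>k\<le>2 * n - 1. s k * m ^ (2 * n - 1 - k))
      else (\<Sum>k\<le>4 * n - 2. s k * m ^ (4 * n - 2 - k))) $ \<mu>) holomorphic_on UNIV" for \<mu> :: 2
    by (cases "\<mu> = 0") (auto intro!: holomorphic_intros)
qed

text \<open>Once the second component is known to be a polynomial, removing its two Laurent halves
  from the first component on the respective patches leaves a section of the trivial bundle, the
  constant \<open>t\<close>.\<close>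

lemma global_section_is_standard:
  assumes "n > 0" "X \<in> global_sections n (4 * n) c"
  obtains t s where "X = standard_section n c t s"
proof -
  obtain w w' where X: "X = (w, w')" by force
  note w = assms(2)[unfolded X mem_global_sections[OF assms(1)]]
  have w'0: "w' (inverse l) $ 0 = w l $ 0 + coupling c / l ^ (2 * n - 1) * w l $ 1"
    and w'1: "w' (inverse l) $ 1 = inverse (l ^ (4 * n - 2)) * w l $ 1" if "l \<noteq> 0" for l
    using w that by (simp_all add: mult_vec_two)
  obtain s where s: "\<And>l. w l $ 1 = (\<Sum>k\<le>4 * n - 2. s k * l ^ k)"
    using section_of_line_bundle[of "\<lambda>l. w l $ 1" "\<lambda>m. w' m $ 1" "4 * n - 2"] w w'1 by auto
  define f where "f l = w l $ 0 + coupling c * (\<Sum>j\<in>{1..2 * n - 1}. s (2 * n - 1 + j) * l ^ j)" for l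
  define g where "g m = w' m $ 0 - coupling c * (\<Sum>k\<le>2 * n - 1. s k * m ^ (2 * n - 1 - k))" for m
  have f: "f l = f 0" for l
  proof (rule section_of_trivial_bundle)
    show "f holomorphic_on UNIV" "g holomorphic_on UNIV"
      using w unfolding f_def g_def by (auto intro!: holomorphic_intros)
    fix l :: complex assume l: "l \<noteq> 0"
    show "f l = g (inverse l)"
      using split_polynomial[OF assms(1) l, of s]
      by (simp add: f_def g_def w'0[OF l] s divide_inverse algebra_simps)
  qed
  have "w l $ 0 = f l - coupling c * (\<Sum>j\<in>{1..2 * n - 1}. s (2 * n - 1 + j) * l ^ j)" for l
    by (simp add: f_def)
  then have "w l $ 0 = f 0 - coupling c * (\<Sum>j\<in>{1..2 * n - 1}. s (2 * n - 1 + j) * l ^ j)" for l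
    by (simp only: f[of l])
  then have "w = fst (standard_section n c (f 0) s)"
    unfolding standard_section_def fun_eq_iff vec_eq_iff forall_two by (simp add: s)
  then have "X = standard_section n c (f 0) s"
    using global_sections_eqI[OF assms standard_section_mem[OF assms(1)]] by (simp add: X)
  with that show thesis by blast
qed

lemma standard_section_inject:
  assumes "n > 0" "standard_section n c t s = standard_section n c t' s'"
  shows "t = t'" and "k \<le> 4 * n - 2 \<Longrightarrow> s k = s' k"
proof -
  have *: "fst (standard_section n c t s) l $ \<mu> = fst (standard_section n c t' s') l $ \<mu>" for l \<mu>
    using assms(2) by simp
  show "t = t'"
    \<comment> \<open>The correction sum starts at \<open>j = 1\<close>, so at the origin the first
      component is \<open>t\<close>.\<close>
    using *[of 0 0] by (simp add: standard_section_def power_0_left sum.neutral)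
  have "(\<Sum>k\<le>4 * n - 2. s k * l ^ k) = (\<Sum>k\<le>4 * n - 2. s' k * l ^ k)" for l
    using *[of l 1] by (simp add: standard_section_def)
  then show "s k = s' k" if "k \<le> 4 * n - 2"
    using polyfun_eq_coeffs[of s "4 * n - 2" s'] that by blast
qed

lemma linear_coordinates_exist:
  assumes "n > 0" and card: "CARD('d::finite) = 4 * n"
  shows "\<exists>\<phi>::complex ^ 'd \<Rightarrow> curve. linear_coordinates n (4 * n) c \<phi>"
proof -
  obtain e :: "nat \<Rightarrow> 'd" where e: "bij_betw e {..<4 * n} UNIV"
    using finite_same_card_bij[of "{..<4 * n}" "UNIV :: 'd set"] card by auto
  \<comment> \<open>Coordinates \<open>0\<close> to \<open>4 * n - 2\<close> carry the polynomial
    coefficients, the last one, \<open>4 * n - 1\<close>, carries the constant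
    \<open>t\<close>.\<close>
  define \<phi> where "\<phi> x = standard_section n c (x $ e (4 * n - 1)) (\<lambda>k. x $ e k)" for x
  have "inj \<phi>"
  proof (rule injI)
    fix x y assume "\<phi> x = \<phi> y"
    then have "x $ e (4 * n - 1) = y $ e (4 * n - 1)" "\<And>k. k \<le> 4 * n - 2 \<Longrightarrow> x $ e k = y $ e k"
      using standard_section_inject[OF assms(1)] unfolding \<phi>_def by blast+
    moreover have "k \<le> 4 * n - 2 \<or> k = 4 * n - 1" if "k < 4 * n" for k
      using that by auto
    ultimately have "x $ e k = y $ e k" if "k < 4 * n" for k
      using that by metis
    then show "x = y"
      using e by (auto simp: vec_eq_iff bij_betw_def image_iff) (metis UNIV_I imageE lessThan_iff)
  qed
  moreover have "range \<phi> = global_sections n (4 * n) c"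
  proof (intro equalityI subsetI)
    fix X assume "X \<in> global_sections n (4 * n) c"
    then obtain t s where X: "X = standard_section n c t s"
      using global_section_is_standard[OF assms(1)] by blast
    define x :: "complex ^ 'd" where
      "x = (\<chi> i. let k = the_inv_into {..<4 * n} e i in if k = 4 * n - 1 then t else s k)"
    have x: "x $ e k = (if k = 4 * n - 1 then t else s k)" if "k < 4 * n" for k
      using the_inv_into_f_f[of e "{..<4 * n}" k] e that by (simp add: x_def bij_betw_def)
    have "k < 4 * n \<and> k \<noteq> 4 * n - 1" if "k \<le> 4 * n - 2" for k
      using assms(1) that by auto
    then have s: "x $ e k = s k" if "k \<le> 4 * n - 2" for k
      using that by (simp add: x)
    have "x $ e (4 * n - 1) = t"
      using x assms(1) by simp
    then have "\<phi> x = X"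
      unfolding \<phi>_def X standard_section_def
      using assms(1) by (intro prod_eqI ext) (auto simp: s vec_eq_iff intro!: sum.cong)
    then show "X \<in> range \<phi>"
      by blast
  qed (auto simp: \<phi>_def standard_section_mem[OF assms(1)])
  ultimately have "linear_coordinates n (4 * n) c \<phi>"
    unfolding linear_coordinates_def bij_betw_def
    by (simp add: \<phi>_def standard_section_def vec_eq_iff algebra_simps sum.distrib sum_distrib_left)
  then show ?thesis
    by blast
qed

section \<open>Splittings of the normal bundle\<close>

lemma invertible_two:
  fixes M :: "complex ^ 2 ^ 2"
  assumes "M $ 0 $ 0 * M $ 1 $ 1 \<noteq> M $ 0 $ 1 * M $ 1 $ 0"
  shows "invertible M"
proof -
  \<comment> \<open>\<open>det_2\<close> is stated for the indices \<open>1\<close> and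
    \<open>2\<close>, and the latter is \<open>0\<close> in this type.\<close>
  have two: "(2 :: 2) = 0" by simp
  show ?thesis
    using assms unfolding invertible_det_nz det_2 two by (simp add: mult.commute)
qed

text \<open>Clearing the inverse of \<open>H\<close> from the defining equation leaves an identity
  that can be checked entrywise.\<close>

lemma splittingI:
  assumes "\<And>l. invertible (H l)" "\<And>m. invertible (H' m)"
    and "\<And>i j. (\<lambda>l. H l $ i $ j) holomorphic_on UNIV" "\<And>i j. (\<lambda>m. H' m $ i $ j) holomorphic_on UNIV"
    and "\<And>l. l \<noteq> 0 \<Longrightarrow> F l ** H l = H' (inverse l) ** diag2 (l powi (- n1)) (l powi (- n2))"
  shows "splitting F n1 n2 H H'"
  unfolding splitting_def
proof (intro conjI allI impI assms(1-4))
  fix l :: complex assume "l \<noteq> 0"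
  then have "H' (inverse l) ** diag2 (l powi (- n1)) (l powi (- n2)) ** matrix_inv (H l) =
      F l ** (H l ** matrix_inv (H l))"
    by (simp add: assms(5) matrix_mul_assoc)
  then show "F l = H' (inverse l) ** diag2 (l powi (- n1)) (l powi (- n2)) ** matrix_inv (H l)"
    by (simp add: matrix_inv_mult[OF assms(1)])
qed

lemma diag2_mult: "((N :: complex ^ 2 ^ 2) ** diag2 a b) $ i $ j = N $ i $ j * (if j = 0 then a else b)"
  using two_exhaust[of j] by (elim disjE) (simp_all add: mult_two diag2_def)

lemma mult_diag2: "(diag2 a b ** (N :: complex ^ 2 ^ 2)) $ i $ j = (if i = 0 then a else b) * N $ i $ j"
  using two_exhaust[of i] by (elim disjE) (simp_all add: mult_two diag2_def)

text \<open>
  The columns of \<open>H\<close> are the restrictions to the first patch of two global sections of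
  \<open>N \<otimes> \<O>(1 - 2 n)\<close>.
\<close>

lemma splitting_finite:
  assumes "n > 0" "a \<noteq> 0"
  shows "\<exists>H H'. splitting (bundle_matrix n (Fin a)) (2 * int n - 1) (2 * int n - 1) H H'"
proof -
  let ?m = "2 * n - 1"
  \<comment> \<open>The entry \<open>- a * l ^ ?m\<close> cancels the \<open>1\<close> against the
    coupling: the transition matrix sends column \<open>0\<close> to \<open>l powi (- ?m)\<close>
    times \<open>(0, - a)\<close>, and column \<open>1\<close> to the same power times
    \<open>(1 / a, inverse l ^ ?m)\<close>. These are the columns of \<open>H'\<close>, and both
    determinants are \<open>1\<close>.\<close>
  define H :: "complex \<Rightarrow> complex ^ 2 ^ 2" where
    "H l = (\<chi> i j. if i = j then 1 else if i = 0 then 0 else - a * l ^ ?m)" for l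
  define H' :: "complex \<Rightarrow> complex ^ 2 ^ 2" where
    "H' m = (\<chi> i j. if i = 0 then if j = 0 then 0 else 1 / a else if j = 0 then - a else m ^ ?m)" for m
  have int_m: "2 * int n - 1 = int ?m"
    using assms(1) by simp
  have power: "l ^ (4 * n - 2) = l ^ ?m * l ^ ?m" for l :: complex
  proof -
    have "4 * n - 2 = ?m + ?m"
      using assms(1) by simp
    then show ?thesis
      by (simp only: power_add)
  qed
  have "splitting (bundle_matrix n (Fin a)) (int ?m) (int ?m) H H'"
  proof (rule splittingI)
    show "invertible (H l)" "invertible (H' l)" for l
      using assms(2) by (auto intro!: invertible_two simp: H_def H'_def)
    show "(\<lambda>l. H l $ i $ j) holomorphic_on UNIV" for i j
      by (cases "i = j"; cases "i = 0") (auto simp: H_def intro!: holomorphic_intros)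
    show "(\<lambda>m. H' m $ i $ j) holomorphic_on UNIV" for i j
      by (cases "i = 0"; cases "j = 0") (auto simp: H'_def intro!: holomorphic_intros)
    fix l :: complex assume "l \<noteq> 0"
    then show "bundle_matrix n (Fin a) l ** H l =
        H' (inverse l) ** diag2 (l powi - int ?m) (l powi - int ?m)"
      using assms(2) unfolding vec_eq_iff forall_two power_int_minus diag2_mult
      by (simp add: mult_two H_def H'_def coupling_def power power_inverse divide_simps)
  qed
  then show ?thesis
    unfolding int_m by blast
qed

lemma bundle_matrix_Infty: "bundle_matrix n Infty l = diag2 1 (inverse (l ^ (4 * n - 2)))"
  by (simp add: vec_eq_iff forall_two diag2_def coupling_def)

lemma splitting_Infty:
  assumes "n > 0"
  shows "\<exists>H H'. splitting (bundle_matrix n Infty) 0 (4 * int n - 2) H H'"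
proof -
  have int_m: "4 * int n - 2 = int (4 * n - 2)"
    using assms by simp
  have "splitting (bundle_matrix n Infty) 0 (4 * int n - 2) (\<lambda>_. mat 1) (\<lambda>_. mat 1)"
  proof (rule splittingI)
    show "invertible (mat 1 :: complex ^ 2 ^ 2)"
      by (auto simp: invertible_def intro!: exI[of _ "mat 1"])
    then show "invertible (mat 1 :: complex ^ 2 ^ 2)" .
  qed (simp_all add: bundle_matrix_Infty int_m power_int_minus)
  then show ?thesis
    by blast
qed

section \<open>The frame section\<close>

locale linear_chart =
  fixes n :: nat and c :: bundle_parameter and \<phi> :: "complex ^ 'd \<Rightarrow> curve"
  assumes n: "n > 0" and chart: "linear_coordinates n (4 * n) c \<phi>"
begin

lemma section_mem: "\<phi> x \<in> global_sections n (4 * n) c"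
  using chart by (auto simp: linear_coordinates_def bij_betw_def)

lemma section_add: "fst (\<phi> (x + y)) l = fst (\<phi> x) l + fst (\<phi> y) l"
  and section_scale: "fst (\<phi> (k *s x)) l = k *s fst (\<phi> x) l"
  using chart by (auto simp: linear_coordinates_def)

lemma section_zero: "fst (\<phi> 0) l = 0"
  using section_scale[of 0 0 l] by simp

lemma section_expand: "fst (\<phi> V) l $ \<mu> = (\<Sum>a\<in>UNIV. V $ a * fst (\<phi> (axis a 1)) l $ \<mu>)"
proof -
  have "fst (\<phi> (\<Sum>a\<in>S. V $ a *s axis a 1)) l = (\<Sum>a\<in>S. V $ a *s fst (\<phi> (axis a 1)) l)" for S
    by (induction S rule: infinite_finite_induct) (auto simp: section_zero section_add section_scale)
  from this[of UNIV] show ?thesis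
    by (simp add: basis_expansion)
qed

lemma section_eq_0:
  assumes "\<And>l. fst (\<phi> V) l = 0"
  shows "V = 0"
proof -
  have "\<phi> V = \<phi> 0"
    using assms section_zero by (intro global_sections_eqI[OF n section_mem section_mem]) auto
  moreover have "inj \<phi>"
    using chart by (simp add: linear_coordinates_def bij_betw_def)
  ultimately show ?thesis
    by (simp add: inj_eq)
qed

lemma dw_nth: "dw \<phi> x l \<mu> $ a = fst (\<phi> (axis a 1)) l $ \<mu>"
proof -
  have "axis a z = z *s axis a 1" for z :: complex
    by (simp add: vec_eq_iff axis_def)
  then have "partial a (\<lambda>y. fst (\<phi> y) l $ \<mu>) x = fst (\<phi> (axis a 1)) l $ \<mu>"
    by (intro partial_affine[where \<alpha> = "fst (\<phi> x) l $ \<mu>"])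
      (metis section_add section_scale vector_add_component vector_smult_component)
  then show ?thesis
    by (simp add: dw_def)
qed

lemma frame_section_nth:
  "frame_section \<phi> H x l A $ a = (matrix_inv (H x l) *v fst (\<phi> (axis a 1)) l) $ A"
  by (simp add: frame_section_def dw_nth sum_two mult_vec_two)

text \<open>Turns statements about the one-forms \<open>v\<close> into statements about the section
  with coordinates \<open>V\<close>.\<close>

lemma pairing_frame_section:
  "pairing (frame_section \<phi> H x l A) V = (matrix_inv (H x l) *v fst (\<phi> V) l) $ A"
  unfolding mult_vec_two section_expand[of V l] pairing_def frame_section_nth
  by (simp add: sum_distrib_left sum.distrib algebra_simps)

text \<open>Applying \<open>matrix_inv (H l)\<close> and \<open>matrix_inv (H' m)\<close> to the two
  representatives diagonalises the patching, so component \<open>A\<close> is a section of a line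
  bundle of degree \<open>k A\<close>. Degrees indexed by \<open>A\<close> cover the balanced and
  the unbalanced splitting at once.\<close>

lemma frame_component_polynomial:
  assumes H: "splitting (bundle_matrix n c) (int (k 0)) (int (k 1)) H H'"
    and w: "(w, w') \<in> global_sections n (4 * n) c"
  obtains q where "\<And>l. (matrix_inv (H l) *v w l) $ A = (\<Sum>j\<le>k A. q j * l ^ j)"
proof -
  note H = H[unfolded splitting_def]
  note w = w[unfolded mem_global_sections[OF n]]
  show thesis
  proof (rule section_of_line_bundle)
    show "(\<lambda>l. (matrix_inv (H l) *v w l) $ A) holomorphic_on UNIV"
      "(\<lambda>m. (matrix_inv (H' m) *v w' m) $ A) holomorphic_on UNIV"
      using H w unfolding mult_vec_two
      by (auto intro!: entire.add entire.mult entire.matrix_inv)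
    fix l :: complex assume l: "l \<noteq> 0"
    define \<Delta> where "\<Delta> = diag2 (l powi - int (k 0)) (l powi - int (k 1))"
    have "w' (inverse l) = H' (inverse l) ** \<Delta> ** matrix_inv (H l) *v w l"
      using H w l by (simp add: \<Delta>_def)
    then have "matrix_inv (H' (inverse l)) *v w' (inverse l) =
        (matrix_inv (H' (inverse l)) ** H' (inverse l)) ** \<Delta> *v (matrix_inv (H l) *v w l)"
      by (simp add: matrix_vector_mul_assoc matrix_mul_assoc)
    also have "\<dots> = \<Delta> *v (matrix_inv (H l) *v w l)"
      using H by (simp add: matrix_inv_mult)
    also have "(\<Delta> *v v) $ A = inverse (l ^ k A) * v $ A" for v
      using two_exhaust[of A] by (elim disjE) (simp_all add: \<Delta>_def mult_vec_two diag2_def power_int_minus)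
    finally have "(matrix_inv (H' (inverse l)) *v w' (inverse l)) $ A =
      inverse (l ^ k A) * (matrix_inv (H l) *v w l) $ A"
      by simp
    then show "(matrix_inv (H l) *v w l) $ A =
        l ^ k A * (matrix_inv (H' (inverse l)) *v w' (inverse l)) $ A"
      using l by simp
  qed (rule that)
qed

lemma matrix_inv_holomorphic:
  assumes "splitting_family n (4 * n) c \<phi> n1 n2 H H'"
  shows "holomorphic_vec (\<lambda>x. matrix_inv (H x l) $ i $ j)"
  using assms unfolding splitting_family_def splitting_def
  by (intro hol.matrix_inv jointly_holomorphic_imp_holomorphic_vec) auto

lemma frame_coefficients:
  assumes H: "splitting_family n (4 * n) c \<phi> (int (k 0)) (int (k 1)) H H'"
  obtains C :: "complex ^ 'd \<Rightarrow> 2 \<Rightarrow> nat \<Rightarrow> complex ^ 'd" where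
    "\<And>x l A a. frame_section \<phi> H x l A $ a = (\<Sum>j\<le>k A. C x A j $ a * l ^ j)"
    "\<And>A j a. j \<le> k A \<Longrightarrow> holomorphic_vec (\<lambda>x. C x A j $ a)"
    "\<And>x V. (\<And>A j. j \<le> k A \<Longrightarrow> pairing (C x A j) V = 0) \<Longrightarrow> V = 0"
proof -
  have split: "splitting (bundle_matrix n c) (int (k 0)) (int (k 1)) (H x) (H' x)" for x
    using H by (simp add: splitting_family_def normal_patching_eq[OF n])
  have "\<exists>q. \<forall>l. frame_section \<phi> H x l A $ a = (\<Sum>j\<le>k A. q j * l ^ j)" for x A a
    unfolding frame_section_nth
    using frame_component_polynomial[OF split, of "fst (\<phi> (axis a 1))" "snd (\<phi> (axis a 1))"]
      section_mem by (metis prod.collapse)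
  then obtain q where q: "\<And>x A a l. frame_section \<phi> H x l A $ a = (\<Sum>j\<le>k A. q x A a j * l ^ j)"
    by metis
  define C where "C x A j = (\<chi> a. q x A a j)" for x A j
  have C: "frame_section \<phi> H x l A $ a = (\<Sum>j\<le>k A. C x A j $ a * l ^ j)" for x l A a
    by (simp add: C_def q)
  show thesis
  proof (rule that)
    show "frame_section \<phi> H x l A $ a = (\<Sum>j\<le>k A. C x A j $ a * l ^ j)" for x l A a
      by (rule C)
    show "holomorphic_vec (\<lambda>x. C x A j $ a)" if "j \<le> k A" for A j a
    \<comment> \<open>The coefficients were chosen curve by curve, so the choice itself says nothing
      about dependence on \<open>x\<close>; at each fixed \<open>l\<close>, however, the polynomial
      is holomorphic in \<open>x\<close>.\<close>
    proof (rule hol.polynomial_coefficients[OF _ that])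
      fix l
      show "holomorphic_vec (\<lambda>x. \<Sum>j\<le>k A. C x A j $ a * l ^ j)"
        unfolding C[symmetric] frame_section_nth mult_vec_two
        by (intro hol.add hol.mult hol.const matrix_inv_holomorphic[OF H])
    qed
    show "V = 0" if V: "\<And>A j. j \<le> k A \<Longrightarrow> pairing (C x A j) V = 0" for x V
    proof (rule section_eq_0)
      fix l
      have "pairing (frame_section \<phi> H x l A) V = (\<Sum>j\<le>k A. pairing (C x A j) V * l ^ j)" for A
        unfolding pairing_def C sum_distrib_right by (subst sum.swap) (simp add: mult_ac)
      then have "matrix_inv (H x l) *v fst (\<phi> V) l = 0"
        by (simp add: V vec_eq_iff flip: pairing_frame_section)
      then have "(H x l ** matrix_inv (H x l)) *v fst (\<phi> V) l = 0"
        by (simp flip: matrix_vector_mul_assoc)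
      then show "fst (\<phi> V) l = 0"
        using split[of x] by (simp add: splitting_def matrix_inv_mult)
    qed
  qed
qed

text \<open>All curves have the same normal patching matrix, so one splitting serves for all of
  them.\<close>

lemma splitting_family_exists:
  assumes "\<exists>H H'. splitting (bundle_matrix n c) n1 n2 H H'"
  shows "\<exists>H H'. splitting_family n (4 * n) c \<phi> n1 n2 H H'"
proof -
  obtain H H' where H: "splitting (bundle_matrix n c) n1 n2 H H'"
    using assms by blast
  then have "splitting_family n (4 * n) c \<phi> n1 n2 (\<lambda>_. H) (\<lambda>_. H')"
    unfolding splitting_family_def normal_patching_eq[OF n]
    by (auto simp: splitting_def intro!: jointly_holomorphic_entire)
  then show ?thesis
    by blast
qed

end

section \<open>Metric and Galilean structure induced by a coframe of polynomial coefficients\<close>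

lemma nondegenerate_frame_metric:
  fixes C :: "complex ^ 'd \<Rightarrow> 2 \<Rightarrow> nat \<Rightarrow> complex ^ 'd"
  assumes k: "odd k" "CARD('d) = 2 * Suc k"
    and hol: "\<And>A j a. j \<le> k \<Longrightarrow> holomorphic_vec (\<lambda>x. C x A j $ a)"
    and inj: "\<And>x V. (\<And>A j. j \<le> k \<Longrightarrow> pairing (C x A j) V = 0) \<Longrightarrow> V = 0"
  shows "nondegenerate_metric (\<lambda>x. frame_metric k (\<lambda>A. symmetric_spinor k (C x A)))"
  unfolding nondegenerate_metric_def symmetric_tensor_field_def
proof (intro conjI allI)
  fix a b
  show "holomorphic_vec (\<lambda>x. frame_metric k (\<lambda>A. symmetric_spinor k (C x A)) $ a $ b)"
    unfolding frame_metric_symmetric_spinor case_prod_unfold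
    by (intro hol.sum hol.mult hol.const hol) auto
next
  fix x
  show "transpose (frame_metric k (\<lambda>A. symmetric_spinor k (C x A))) =
      frame_metric k (\<lambda>A. symmetric_spinor k (C x A))"
    by (rule transpose_frame_metric[OF k(1)])
  \<comment> \<open>The coframe is indexed by \<open>2 * Suc k\<close> pairs, and
    \<open>\<sigma>\<close> swaps the unprimed index and reverses the power of \<lambda>.\<close>
  define P where "P = (UNIV :: 2 set) \<times> {..k}"
  define s where "s = (\<lambda>(A, j). skew (1 - A) A * (- 1) ^ j / of_nat (k choose j))"
  define \<sigma> :: "2 \<times> nat \<Rightarrow> 2 \<times> nat" where "\<sigma> = (\<lambda>(A, j). (1 - A, k - j))"
  have "invertible (\<chi> a b. \<Sum>p\<in>P. s p * case_prod (C x) (\<sigma> p) $ a * case_prod (C x) p $ b)"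
  proof (rule invertible_monomial_form)
    show "card P = CARD('d)"
      by (simp add: P_def k)
    show "V = 0" if "\<And>p. p \<in> P \<Longrightarrow> pairing (case_prod (C x) p) V = 0" for V
      by (rule inj[of x]) (use that in \<open>auto simp: P_def\<close>)
    show "inj_on \<sigma> P"
      by (auto simp: inj_on_def \<sigma>_def P_def)
    show "s p \<noteq> 0" if "p \<in> P" for p
      using that by (auto simp: s_def P_def skew_flip split: if_splits)
  qed (auto simp: P_def \<sigma>_def)
  moreover have "frame_metric k (\<lambda>A. symmetric_spinor k (C x A)) =
      (\<chi> a b. \<Sum>p\<in>P. s p * case_prod (C x) (\<sigma> p) $ a * case_prod (C x) p $ b)"
    by (simp add: vec_eq_iff frame_metric_symmetric_spinor P_def s_def \<sigma>_def case_prod_unfold)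
  ultimately show "invertible (frame_metric k (\<lambda>A. symmetric_spinor k (C x A)))"
    by simp
qed

lemma induces_galilean_structure_spatial_metric:
  fixes c :: "complex ^ 'd \<Rightarrow> nat \<Rightarrow> complex ^ 'd"
  assumes k: "even k" "CARD('d) = Suc (Suc k)" and \<theta>: "closed_one_form \<theta>"
    and hol: "\<And>j a. j \<le> k \<Longrightarrow> holomorphic_vec (\<lambda>x. c x j $ a)"
    and inj: "\<And>x V. pairing (\<theta> x) V = 0 \<Longrightarrow> (\<And>j. j \<le> k \<Longrightarrow> pairing (c x j) V = 0) \<Longrightarrow> V = 0"
  shows "induces_galilean_structure (\<lambda>x. spatial_metric k (symmetric_spinor k (c x))) \<theta>"
proof (rule induces_galilean_structureI[OF _ \<theta>])
  show "symmetric_tensor_field (\<lambda>x. spatial_metric k (symmetric_spinor k (c x)))"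
    unfolding symmetric_tensor_field_def transpose_spatial_metric[OF k(1)]
      spatial_metric_symmetric_spinor
    by (intro conjI allI refl hol.sum hol.mult hol.const hol) auto
next
  fix x
  \<comment> \<open>The index \<open>None\<close> adjoins the clock to the spatial coefficients: it
    is fixed by \<open>\<sigma>\<close> with weight \<open>1\<close>, so its summand is exactly
    \<open>outer (\<theta> x) (\<theta> x)\<close>.\<close>
  define P where "P = insert None (Some ` {..k})"
  define e where "e = case_option (\<theta> x) (c x)"
  define s where "s = case_option 1 (\<lambda>j. (- 1) ^ j / complex_of_nat (k choose j))"
  define \<sigma> where "\<sigma> = map_option (\<lambda>j. k - j)"
  have P: "finite P" "card P = CARD('d)"
    by (auto simp: P_def k card_image)
  have sum_P: "(\<Sum>p\<in>P. f p) = f None + (\<Sum>j\<le>k. f (Some j))" for f :: "nat option \<Rightarrow> complex"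
    by (simp add: P_def sum.reindex)
  have trivial: "V = 0" if V: "\<And>p. p \<in> P \<Longrightarrow> pairing (e p) V = 0" for V
    using V[of None] V[of "Some _"] by (intro inj[of x]) (auto simp: P_def e_def)
  have "invertible (\<chi> a b. \<Sum>p\<in>P. s p * e (\<sigma> p) $ a * e p $ b)"
    by (rule invertible_monomial_form[OF P trivial]) (auto simp: P_def \<sigma>_def s_def inj_on_def)
  moreover have "(\<chi> a b. \<Sum>p\<in>P. s p * e (\<sigma> p) $ a * e p $ b) =
      spatial_metric k (symmetric_spinor k (c x)) + outer (\<theta> x) (\<theta> x)"
    unfolding sum_P
    by (simp add: vec_eq_iff s_def e_def \<sigma>_def outer_def spatial_metric_symmetric_spinor)
  ultimately show "invertible (spatial_metric k (symmetric_spinor k (c x)) + outer (\<theta> x) (\<theta> x))"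
    by simp
  \<comment> \<open>The vector dual to the clock pairs to zero with all spatial coefficients, hence
    is annihilated by the spatial metric and provides the observer.\<close>
  obtain W where W: "\<And>p q. p \<in> P \<Longrightarrow> q \<in> P \<Longrightarrow> pairing (e p) (W q) = (if p = q then 1 else 0)"
    using dual_basis[OF P trivial] by blast
  have U: "pairing (\<theta> x) (W None) = 1" "\<And>j. j \<le> k \<Longrightarrow> pairing (c x j) (W None) = 0"
    using W[of None None] W[of "Some _" None] by (auto simp: P_def e_def)
  have "spatial_metric k (symmetric_spinor k (c x)) =
      (\<chi> a b. \<Sum>j\<le>k. (- 1) ^ j / of_nat (k choose j) * c x (k - j) $ a * c x j $ b)"
    by (simp add: vec_eq_iff spatial_metric_symmetric_spinor)
  then have "(spatial_metric k (symmetric_spinor k (c x)) *v W None) $ a =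
      (\<Sum>j\<le>k. (- 1) ^ j / of_nat (k choose j) * c x (k - j) $ a * pairing (c x j) (W None))" for a
    by (simp only: monomial_form_mult[where c = "c x" and \<sigma> = "\<lambda>j. k - j"
          and s = "\<lambda>j. (- 1) ^ j / of_nat (k choose j)"])
  then have "spatial_metric k (symmetric_spinor k (c x)) *v W None = 0"
    by (simp add: vec_eq_iff U)
  with U show "\<exists>V. field_of_observers (spatial_metric k (symmetric_spinor k (c x))) (\<theta> x) V"
    unfolding field_of_observers_def by blast
qed

lemma closed_one_form_const: "closed_one_form (\<lambda>_. \<alpha>)" for \<alpha> :: "complex ^ 'd"
proof -
  have "partial a (\<lambda>_. z) x = 0" for a z and x :: "complex ^ 'd"
    by (rule partial_affine[where \<alpha> = z]) simp
  then show ?thesis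
    by (simp add: closed_one_form_def holomorphic_one_form_def hol.const)
qed

lemma splitting_Infty_frame:
  assumes n: "n > 0" and H: "splitting (bundle_matrix n Infty) 0 (int (4 * n - 2)) H H'"
  shows "matrix_inv (H l) $ 0 $ 1 = 0" and "matrix_inv (H l) $ 0 $ 0 \<noteq> 0"
proof -
  note H = H[unfolded splitting_def]
  have zero: "matrix_inv (H l) $ 0 $ 1 = 0" for l
  proof (rule section_of_negative_bundle[where f = "\<lambda>l. matrix_inv (H l) $ 0 $ 1"
        and g = "\<lambda>m. matrix_inv (H' m) $ 0 $ 1" and k = "4 * n - 2"])
    show "(\<lambda>l. matrix_inv (H l) $ 0 $ 1) holomorphic_on UNIV"
      "(\<lambda>m. matrix_inv (H' m) $ 0 $ 1) holomorphic_on UNIV"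
      using H by (auto intro!: entire.matrix_inv)
    show "4 * n - 2 > 0"
      using n by simp
    fix l :: complex assume l: "l \<noteq> 0"
    define \<Delta> where "\<Delta> = diag2 1 (inverse (l ^ (4 * n - 2)))"
    \<comment> \<open>For \<open>Infty\<close> the transition matrix already is the diagonal model,
      so the splitting equation says that the inverse frames intertwine \<open>\<Delta>\<close> with
      itself across the patches.\<close>
    have "\<Delta> = H' (inverse l) ** \<Delta> ** matrix_inv (H l)"
      using H l by (simp add: \<Delta>_def bundle_matrix_Infty power_int_minus)
    then have "matrix_inv (H' (inverse l)) ** \<Delta> =
        (matrix_inv (H' (inverse l)) ** H' (inverse l)) ** (\<Delta> ** matrix_inv (H l))"
      by (metis matrix_mul_assoc)
    then have "(matrix_inv (H' (inverse l)) ** \<Delta>) $ 0 $ 1 = (\<Delta> ** matrix_inv (H l)) $ 0 $ 1"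
      using H by (simp add: matrix_inv_mult)
    then show "l ^ (4 * n - 2) * matrix_inv (H l) $ 0 $ 1 = matrix_inv (H' (inverse l)) $ 0 $ 1"
      using l by (simp add: \<Delta>_def diag2_mult mult_diag2 field_simps)
  qed
  show "matrix_inv (H l) $ 0 $ 1 = 0"
    by (rule zero)
  \<comment> \<open>With the off-diagonal entry gone, this entry is a product with
    \<open>matrix_inv (H l) $ 0 $ 0\<close> as a factor.\<close>
  have "(matrix_inv (H l) ** H l) $ 0 $ 0 = 1"
    using H by (simp add: matrix_inv_mult mat_def)
  then show "matrix_inv (H l) $ 0 $ 0 \<noteq> 0"
    by (auto simp: mult_two zero)
qed

section \<open>The frame section for finite and for infinite parameter\<close>

lemma frame_section_finite:
  fixes \<phi> :: "complex ^ 'd \<Rightarrow> curve"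
  assumes n: "n > 0" and card: "CARD('d) = 4 * n" and \<phi>: "linear_coordinates n (4 * n) (Fin a) \<phi>"
    and H: "splitting_family n (4 * n) (Fin a) \<phi> (2 * int n - 1) (2 * int n - 1) H H'"
  shows "\<exists>e. (\<forall>A. symmetric_one_forms (2 * n - 1) (\<lambda>x. e x A)) \<and>
    (\<forall>x A. homogeneous_form (2 * n - 1) (e x A) (\<lambda>l. frame_section \<phi> H x l A)) \<and>
    nondegenerate_metric (\<lambda>x. frame_metric (2 * n - 1) (e x))"
proof -
  interpret linear_chart n "Fin a" \<phi>
    by unfold_locales (fact n, fact \<phi>)
  have int_m: "2 * int n - 1 = int (2 * n - 1)"
    using n by simp
  note H = H[unfolded int_m]
  obtain C where C:
    "\<And>x l A b. frame_section \<phi> H x l A $ b = (\<Sum>j\<le>2 * n - 1. C x A j $ b * l ^ j)"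
    "\<And>A j b. j \<le> 2 * n - 1 \<Longrightarrow> holomorphic_vec (\<lambda>x. C x A j $ b)"
    "\<And>x V. (\<And>A j. j \<le> 2 * n - 1 \<Longrightarrow> pairing (C x A j) V = 0) \<Longrightarrow> V = 0"
    using frame_coefficients[where k = "\<lambda>_. 2 * n - 1", OF H] by blast
  show ?thesis
  proof (intro exI[of _ "\<lambda>x A. symmetric_spinor (2 * n - 1) (C x A)"] conjI allI)
    show "nondegenerate_metric (\<lambda>x. frame_metric (2 * n - 1) (\<lambda>A. symmetric_spinor (2 * n - 1) (C x A)))"
    proof (rule nondegenerate_frame_metric[OF _ _ C(2,3)])
      show "odd (2 * n - 1)"
        using n by simp
      show "CARD('d) = 2 * Suc (2 * n - 1)"
        unfolding card using n by simp
    qed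
    show "symmetric_one_forms (2 * n - 1) (\<lambda>x. symmetric_spinor (2 * n - 1) (C x A))" for A
      by (intro symmetric_one_forms_symmetric_spinor C(2))
    show "homogeneous_form (2 * n - 1) (symmetric_spinor (2 * n - 1) (C x A))
        (\<lambda>l. frame_section \<phi> H x l A)" for x A
      by (intro homogeneous_form_symmetric_spinor C(1))
  qed
qed

lemma frame_section_Infty:
  fixes \<phi> :: "complex ^ 'd \<Rightarrow> curve"
  assumes n: "n > 0" and card: "CARD('d) = 4 * n" and \<phi>: "linear_coordinates n (4 * n) Infty \<phi>"
    and H: "splitting_family n (4 * n) Infty \<phi> 0 (4 * int n - 2) H H'"
  shows "\<exists>\<theta> e. holomorphic_one_form \<theta> \<and> symmetric_one_forms (4 * n - 2) e \<and>
    (\<forall>x l. frame_section \<phi> H x l 0 = \<theta> x) \<and>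
    (\<forall>x. homogeneous_form (4 * n - 2) (e x) (\<lambda>l. frame_section \<phi> H x l 1)) \<and>
    (\<exists>f. holomorphic_vec f \<and> (\<forall>x. f x \<noteq> 0) \<and>
      induces_galilean_structure (\<lambda>x. spatial_metric (4 * n - 2) (e x)) (\<lambda>x. f x *s \<theta> x))"
proof -
  interpret linear_chart n Infty \<phi>
    by unfold_locales (fact n, fact \<phi>)
  define k where "k A = (if A = 0 then 0 else 4 * n - 2)" for A :: 2
  have int_m: "4 * int n - 2 = int (4 * n - 2)"
    using n by simp
  have "splitting_family n (4 * n) Infty \<phi> (int (k 0)) (int (k 1)) H H'"
    using H unfolding int_m by (simp add: k_def)
  then obtain C where C:
    "\<And>x l A a. frame_section \<phi> H x l A $ a = (\<Sum>j\<le>k A. C x A j $ a * l ^ j)"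
    "\<And>A j a. j \<le> k A \<Longrightarrow> holomorphic_vec (\<lambda>x. C x A j $ a)"
    "\<And>x V. (\<And>A j. j \<le> k A \<Longrightarrow> pairing (C x A j) V = 0) \<Longrightarrow> V = 0"
    using frame_coefficients by blast
  have split: "splitting (bundle_matrix n Infty) 0 (int (4 * n - 2)) (H x) (H' x)" for x
    using H unfolding int_m splitting_family_def normal_patching_eq[OF n] by blast
  \<comment> \<open>Row \<open>0\<close> of the inverse frame is \<open>(u, 0)\<close> with
    \<open>u\<close> nonzero, so the clock is \<open>u\<close> times the differential of the first
    fibre coordinate. Dividing by \<open>u\<close>, taken at the origin of the line, leaves the
    constant form \<open>\<tau>\<close>, which is closed.\<close>
  define f where "f x = inverse (matrix_inv (H x 0) $ 0 $ 0)" for x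
  have f: "holomorphic_vec f" "\<And>x. f x \<noteq> 0"
    using splitting_Infty_frame(2)[OF n split] matrix_inv_holomorphic[OF H]
    unfolding f_def by (auto intro!: hol.inverse)
  define \<tau> :: "complex ^ 'd" where "\<tau> = (\<chi> a. fst (\<phi> (axis a 1)) 0 $ 0)"
  \<comment> \<open>Degree \<open>0\<close> leaves a single coefficient, so the clock does not
    depend on \<open>l\<close>.\<close>
  have clock: "frame_section \<phi> H x l 0 = C x 0 0" for x l
    by (simp add: vec_eq_iff C(1) k_def)
  have "f x *s frame_section \<phi> H x 0 0 = \<tau>" for x
    using splitting_Infty_frame[OF n split, of x 0]
    by (simp add: vec_eq_iff f_def \<tau>_def frame_section_nth mult_vec_two)
  then have \<tau>: "f x *s C x 0 0 = \<tau>" for x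
    by (simp add: clock)
  have "induces_galilean_structure
      (\<lambda>x. spatial_metric (4 * n - 2) (symmetric_spinor (4 * n - 2) (C x 1))) (\<lambda>_. \<tau>)"
  proof (rule induces_galilean_structure_spatial_metric[OF _ _ closed_one_form_const])
    show "even (4 * n - 2)"
      by simp
    show "CARD('d) = Suc (Suc (4 * n - 2))"
      unfolding card using n by simp
    show "holomorphic_vec (\<lambda>x. C x 1 j $ a)" if "j \<le> 4 * n - 2" for j a
      using that by (intro C(2)) (simp add: k_def)
    fix x V
    assume V: "pairing \<tau> V = 0" "\<And>j. j \<le> 4 * n - 2 \<Longrightarrow> pairing (C x 1 j) V = 0"
    then have "pairing (C x 0 0) V = 0"
      using f(2)[of x] by (simp add: pairing_scale_left flip: \<tau>[of x])
    then show "V = 0"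
    proof (intro C(3)[of x])
      fix A j assume "pairing (C x 0 0) V = 0" "j \<le> k A"
      then show "pairing (C x A j) V = 0"
        using V(2) two_exhaust[of A] by (auto simp: k_def)
    qed
  qed
  then have "induces_galilean_structure
      (\<lambda>x. spatial_metric (4 * n - 2) (symmetric_spinor (4 * n - 2) (C x 1))) (\<lambda>x. f x *s C x 0 0)"
    by (simp add: \<tau>)
  moreover have "holomorphic_one_form (\<lambda>x. C x 0 0)"
    unfolding holomorphic_one_form_def by (intro allI C(2)) simp
  moreover have "symmetric_one_forms (4 * n - 2) (\<lambda>x. symmetric_spinor (4 * n - 2) (C x 1))"
    by (intro symmetric_one_forms_symmetric_spinor C(2)) (simp add: k_def)
  moreover have "homogeneous_form (4 * n - 2) (symmetric_spinor (4 * n - 2) (C x 1))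
      (\<lambda>l. frame_section \<phi> H x l 1)" for x
    by (intro homogeneous_form_symmetric_spinor) (simp add: C(1) k_def)
  ultimately show ?thesis
    using f clock by blast
qed

theorem theorem2p4:
  fixes n D :: nat
  assumes "n > 0" and "D = 4 * n" and "CARD('d::finite) = D"
  shows
    "(\<forall>a::complex. a \<noteq> 0 \<longrightarrow>
        (\<forall>X\<in>global_sections n D (Fin a).
           isomorphic_to_sum (normal_patching n D (Fin a) X) (2 * int n - 1) (2 * int n - 1)) \<and>
        (\<exists>\<phi>::complex ^ 'd \<Rightarrow> curve. linear_coordinates n D (Fin a) \<phi>) \<and>
        (\<forall>\<phi>::complex ^ 'd \<Rightarrow> curve. linear_coordinates n D (Fin a) \<phi> \<longrightarrow>
           (\<exists>H H'. splitting_family n D (Fin a) \<phi> (2 * int n - 1) (2 * int n - 1) H H') \<and>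
           (\<forall>H H'. splitting_family n D (Fin a) \<phi> (2 * int n - 1) (2 * int n - 1) H H' \<longrightarrow>
              (\<exists>e. (\<forall>A. symmetric_one_forms (2 * n - 1) (\<lambda>x. e x A)) \<and>
                   (\<forall>x A. homogeneous_form (2 * n - 1) (e x A)
                            (\<lambda>l. frame_section \<phi> H x l A)) \<and>
                   nondegenerate_metric (\<lambda>x. frame_metric (2 * n - 1) (e x)))))) \<and>
     (\<forall>X\<in>global_sections n D Infty.
        isomorphic_to_sum (normal_patching n D Infty X) 0 (4 * int n - 2)) \<and>
     (\<exists>\<phi>::complex ^ 'd \<Rightarrow> curve. linear_coordinates n D Infty \<phi>) \<and>
     (\<forall>\<phi>::complex ^ 'd \<Rightarrow> curve. linear_coordinates n D Infty \<phi> \<longrightarrow>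
        (\<exists>H H'. splitting_family n D Infty \<phi> 0 (4 * int n - 2) H H') \<and>
        (\<forall>H H'. splitting_family n D Infty \<phi> 0 (4 * int n - 2) H H' \<longrightarrow>
           (\<exists>\<theta> e. holomorphic_one_form \<theta> \<and> symmetric_one_forms (4 * n - 2) e \<and>
                  (\<forall>x l. frame_section \<phi> H x l 0 = \<theta> x) \<and>
                  (\<forall>x. homogeneous_form (4 * n - 2) (e x) (\<lambda>l. frame_section \<phi> H x l 1)) \<and>
                  (\<exists>f. holomorphic_vec f \<and> (\<forall>x. f x \<noteq> 0) \<and>
                       induces_galilean_structure (\<lambda>x. spatial_metric (4 * n - 2) (e x))
                         (\<lambda>x. f x *s \<theta> x)))))"
proof -
  note n = \<open>n > 0\<close> and D = \<open>D = 4 * n\<close> and card = \<open>CARD('d) = D\<close>[unfolded D]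
  have split: "\<exists>H H'. splitting_family n (4 * n) c \<phi> n1 n2 H H'"
    if "linear_coordinates n (4 * n) c \<phi>" "\<exists>H H'. splitting (bundle_matrix n c) n1 n2 H H'"
    for c n1 n2 and \<phi> :: "complex ^ 'd \<Rightarrow> curve"
    using linear_chart.splitting_family_exists[OF linear_chart.intro[OF n that(1)] that(2)] .
  show ?thesis
    unfolding D isomorphic_to_sum_def normal_patching_eq[OF n]
    by (intro conjI allI ballI impI splitting_finite[OF n] splitting_Infty[OF n]
        linear_coordinates_exist[OF n card] split
        frame_section_finite[OF n card] frame_section_Infty[OF n card])
qed

end
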